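(* Assume the Lindelöf Hypothesis (i.e. $|\zeta(\tfrac12+it)|\ll_\varepsilon (1+|t|)^{\varepsilon}$ for every $\varepsilon>0$). Let $X=(x_n)_{n\ge1}$ be a sequence of positive real numbers such that there is a constant $c>0$ with $x_{n+1}-x_n\ge c$ for all $n$, and such that $x_n$ has polynomial growth: there is a constant $C$ with $x_n\ll n^{C}$. Suppose that for some $\beta$ and every $\varepsilon>0$, $$E^{*}(X,N)\ll N^{\beta+\varepsilon}.$$ Then for almost every $\alpha\in\mathbb{R}$, $$\delta_{\min}^{\alpha}(N)<\frac{1}{N^{4-\beta-o(1)}},$$ where the rate of decay of the $o(1)$ term depends on $\alpha$.
   Context: For $x\in\mathbb{R}$, $\|x\|=\min_{k\in\mathbb{Z}}|x-k|$. For $\alpha\in\mathbb{R}$, $\delta_{\min}^{\alpha}(N)=\min\{\|\alpha x_m-\alpha x_n\| : 1\le m,n\le N,\ m\ne n\}$. The additive energy is $E^{*}(X,N)=\#\{(n_1,n_2,n_3,n_4)\in[1,N]^4 : |x_{n_1}+x_{n_2}-x_{n_3}-x_{n_4}|<1\}$. The notation $\frac{1}{N^{\kappa-o(1)}}$ means $N^{-(\kappa-f_\alpha(N))}$ for some function $f_\alpha(N)\to0$ as $N\to\infty$, the inequality holding for all sufficiently large $N$. *)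

theory Defs
  imports "HOL-Analysis.Analysis"
begin

text \<open>Riemann zeta function on the half plane Re s > 0 (which contains the critical line),
  via the Dirichlet eta function: zeta(s) = eta(s) / (1 - 2^(1-s)),
  eta(s) = sum_{n>=1} (-1)^(n-1) n^(-s).\<close>
definition dirichlet_eta :: "complex \<Rightarrow> complex" where
  "dirichlet_eta s = (\<Sum>n. (-1) ^ n / (of_nat (Suc n)) powr s)"

definition zeta_halfplane :: "complex \<Rightarrow> complex" where
  "zeta_halfplane s = dirichlet_eta s / (1 - 2 powr (1 - s))"

definition lindelof_hypothesis :: bool where
  "lindelof_hypothesis \<longleftrightarrow>
     (\<forall>\<epsilon>>0. \<exists>K. \<forall>t::real.
        norm (zeta_halfplane (Complex (1/2) t)) \<le> K * (1 + \<bar>t\<bar>) powr \<epsilon>)"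

definition dist_nint :: "real \<Rightarrow> real" where
  "dist_nint x = (INF k::int. \<bar>x - of_int k\<bar>)"

definition delta_min :: "(nat \<Rightarrow> real) \<Rightarrow> real \<Rightarrow> nat \<Rightarrow> real" where
  "delta_min x \<alpha> N = Min {dist_nint (\<alpha> * x m - \<alpha> * x n) | m n. m \<in> {1..N} \<and> n \<in> {1..N} \<and> m \<noteq> n}"

definition add_energy :: "(nat \<Rightarrow> real) \<Rightarrow> nat \<Rightarrow> nat" where
  "add_energy x N = card {(n1, n2, n3, n4). n1 \<in> {1..N} \<and> n2 \<in> {1..N} \<and> n3 \<in> {1..N} \<and> n4 \<in> {1..N}
       \<and> \<bar>x n1 + x n2 - x n3 - x n4\<bar> < 1}"

end

theory Submission
  imports Defs "HOL-Probability.Probability" "HOL-Real_Asymp.Real_Asymp"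
begin

text \<open>
  Write \<open>\<alpha> = exp y\<close>. For a family of differences \<open>z = x\<^sub>m - x\<^sub>n\<close> in a dyadic block \<open>[Z, 2 Z]\<close>,
  count the near-coincidences \<open>\<alpha> z \<approx> j\<close> with a Gaussian of width \<open>\<eta>\<close> in \<open>ln (\<alpha> z / j)\<close>.
  By Muentz' formula the deviation of this count from its mean is the inverse Fourier
  transform in \<open>y\<close> of a Gaussian times \<open>\<zeta>(1/2 + i t) \<Sum> z\<^bsup>i t\<^esup>\<close>. Bounding zeta by the Lindelof
  hypothesis, a Plancherel inequality and the positivity of the Gaussian bound its mean square
  by the number of pairs \<open>(z, z')\<close> with \<open>|z - z'| < 1\<close>, i.e. by the additive energy.
  If \<open>\<parallel>\<alpha> z\<parallel> \<ge> \<delta>\<close> for all \<open>z\<close> in the block, the count is negligible and the deviation equals the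
  mean up to sign, so by Chebyshev such \<open>\<alpha>\<close> are rare. Borel-Cantelli along \<open>N = 2\<^bsup>k\<^esup>\<close> and the
  monotonicity of the minimal gap conclude.
\<close>

section \<open>Gaussian integrals\<close>

text \<open>In the variable \<open>y\<close> the count is a sum of translates, by the numbers
  \<open>ln z\<close>, of one function; this is why its transform splits into zeta times a single
  exponential sum. No contour has to be moved: for 0 < Re s < 1 the integral of the fractional part
  against v^(-s-1) equals -zeta(s)/s, and identity minus floor turns into mean minus count. A dyadic
  block serves two purposes. At a parameter without coincidences all deviations have the same sign
  and comparable size, so they add up without cancellation; and \<open>|z - z'| \<ge> 1\<close>
  forces \<open>|ln z - ln z'| \<ge> 1 / (2 Z)\<close>, which links the Gaussian double sum to the
  energy. With \<open>\<delta> = N^(-\<kappa>)\<close> the width is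
  \<open>\<eta> = N^(-\<kappa>-\<rho>) / Z\<close>, slightly narrower than the forced gap, so the
  count is negligible. A block holds q \<ge> N^(2-\<rho>) differences, and Chebyshev bounds the bad
  set by about E* / (\<eta> Z q^2), that is N^(\<kappa>+\<beta>-4) up to small powers. Here Z
  cancels, so the size of \<open>x n\<close> costs only arbitrarily small powers of N.\<close>

lemma integral_deriv_half_line:
  fixes F f :: "real \<Rightarrow> 'a::euclidean_space"
  assumes F: "\<And>x. (F has_vector_derivative f x) (at x)"
    and f: "continuous_on UNIV f" "integrable lborel f" and B: "(F \<longlongrightarrow> B) at_top"
  shows "(LINT x|lborel. indicator {a<..} x *\<^sub>R f x) = B - F a"
proof -
  have "isCont F a"
    using F has_vector_derivative_continuous by blast
  then have A: "(F \<longlongrightarrow> F a) (at_right a)"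
    by (simp add: isCont_def filterlim_at_split)
  have "(LBINT x=ereal a..\<infinity>. f x) = B - F a"
  proof (rule interval_integral_FTC_integrable[where F = F])
    show "set_integrable lborel (einterval (ereal a) \<infinity>) f"
      by (rule set_integrable_subset[of _ UNIV]) (use f in \<open>auto simp: set_integrable_def\<close>)
    show "((F \<circ> real_of_ereal) \<longlongrightarrow> F a) (at_right (ereal a))"
      using A by (simp add: ereal_tendsto_simps)
    show "((F \<circ> real_of_ereal) \<longlongrightarrow> B) (at_left \<infinity>)"
      using B by (simp add: ereal_tendsto_simps)
  qed (use F f in \<open>auto simp: continuous_on_eq_continuous_at\<close>)
  then show ?thesis
    by (simp add: interval_lebesgue_integral_def set_lebesgue_integral_def einterval_def greaterThan_def)
qed

lemma integral_deriv_line: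
  fixes F f :: "real \<Rightarrow> 'a::euclidean_space"
  assumes F: "\<And>x. (F has_vector_derivative f x) (at x)"
    and f: "continuous_on UNIV f" "integrable lborel f"
    and A: "(F \<longlongrightarrow> A) at_bot" and B: "(F \<longlongrightarrow> B) at_top"
  shows "integral\<^sup>L lborel f = B - A"
proof -
  have "(LBINT x=-\<infinity>..\<infinity>. f x) = B - A"
  proof (rule interval_integral_FTC_integrable[where F = F])
    show "set_integrable lborel (einterval (-\<infinity>) \<infinity>) f"
      by (rule set_integrable_subset[of _ UNIV]) (use f in \<open>auto simp: set_integrable_def\<close>)
    show "((F \<circ> real_of_ereal) \<longlongrightarrow> A) (at_right (-\<infinity>))"
      using A by (simp add: ereal_tendsto_simps)
    show "((F \<circ> real_of_ereal) \<longlongrightarrow> B) (at_left \<infinity>)"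
      using B by (simp add: ereal_tendsto_simps)
  qed (use F f in \<open>auto simp: continuous_on_eq_continuous_at\<close>)
  then show ?thesis
    by (simp add: interval_lebesgue_integral_def set_lebesgue_integral_def einterval_def)
qed

text \<open>This is the characteristic function of the standard normal law, rescaled by
  \<open>\<eta>\<close>.\<close>

lemma has_bochner_integral_gauss_iexp:
  assumes "\<eta> > 0"
  shows "has_bochner_integral lborel (\<lambda>t. complex_of_real (exp (- (\<eta> * t)\<^sup>2 / 2)) * iexp (t * x))
           (of_real (sqrt (2 * pi) / \<eta> * exp (- x\<^sup>2 / (2 * \<eta>\<^sup>2))))"
proof -
  interpret std: real_distribution std_normal_distribution
    by (rule real_dist_normal_dist)
  have "integrable std_normal_distribution (\<lambda>t. iexp (y * t))" for y
    by (rule std.integrable_iexp) auto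
  then have "has_bochner_integral std_normal_distribution (\<lambda>t. iexp (y * t)) (of_real (exp (- y\<^sup>2 / 2)))" for y
    unfolding fun_cong[OF char_std_normal_distribution, symmetric] char_def by (rule has_bochner_integral_integrable)
  note int = this
  have base: "has_bochner_integral lborel (\<lambda>t. std_normal_density t *\<^sub>R iexp (y * t)) (of_real (exp (- y\<^sup>2 / 2)))" for y
    using int[of y]
    by (auto simp: has_bochner_integral_iff integrable_density integral_density normal_density_nonneg)
  have *: "has_bochner_integral lborel (\<lambda>t. complex_of_real (exp (- t\<^sup>2 / 2)) * iexp (y * t))
     (of_real (sqrt (2 * pi) * exp (- y\<^sup>2 / 2)))" for y
    using has_bochner_integral_scaleR_right[OF base[of y], of "sqrt (2 * pi)"]
    by (simp add: std_normal_density_def scaleR_conv_of_real mult_ac)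
  have "has_bochner_integral lborel
      (\<lambda>t. complex_of_real (exp (- (0 + \<eta> * t)\<^sup>2 / 2)) * iexp (x / \<eta> * (0 + \<eta> * t)))
      (of_real (sqrt (2 * pi) * exp (- (x / \<eta>)\<^sup>2 / 2)) /\<^sub>R \<bar>\<eta>\<bar>)"
    using lborel_has_bochner_integral_real_affine_iff[THEN iffD1, OF _ *[of "x / \<eta>"], of \<eta> 0] assms by blast
  moreover have "x / \<eta> * (0 + \<eta> * t) = t * x" for t
    using assms by simp
  moreover have "of_real (sqrt (2 * pi) * exp (- (x / \<eta>)\<^sup>2 / 2)) /\<^sub>R \<bar>\<eta>\<bar>
      = complex_of_real (sqrt (2 * pi) / \<eta> * exp (- x\<^sup>2 / (2 * \<eta>\<^sup>2)))"
  proof -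
    have "- (x / \<eta>)\<^sup>2 / 2 = - x\<^sup>2 / (2 * \<eta>\<^sup>2)" "\<bar>\<eta>\<bar> = \<eta>"
      using assms by (simp_all add: power_divide)
    then show ?thesis
      by (simp only: scaleR_conv_of_real flip: of_real_mult) (simp add: field_simps)
  qed
  ultimately show ?thesis by (simp only: add_0)
qed

lemma has_bochner_integral_gauss:
  assumes "\<eta> > 0"
  shows "has_bochner_integral lborel (\<lambda>t. exp (- (\<eta> * t)\<^sup>2 / 2 :: real)) (sqrt (2 * pi) / \<eta>)"
  using has_bochner_integral_bounded_linear[OF bounded_linear_Re has_bochner_integral_gauss_iexp[OF assms, of 0]]
  by simp

lemma integrable_gauss_moment:
  assumes "\<eta> > 0"
  shows "integrable lborel (\<lambda>t. exp (- (\<eta> * t)\<^sup>2 / 2 :: real) * \<bar>t\<bar> ^ k)"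
proof -
  have "integrable lborel (\<lambda>t. sqrt (2 * pi) * (std_normal_density t * \<bar>t\<bar> ^ k))"
    using integrable_std_normal_moment_abs by (intro integrable_mult_right) auto
  then have "integrable lborel (\<lambda>t. exp (- t\<^sup>2 / 2 :: real) * \<bar>t\<bar> ^ k)"
    by (simp add: std_normal_density_def)
  from lborel_integrable_real_affine[OF this, of \<eta> 0] assms
  have "integrable lborel (\<lambda>t. exp (- (\<eta> * t)\<^sup>2 / 2 :: real) * (\<bar>t\<bar> ^ k * \<eta> ^ k))"
    by (simp add: abs_mult power_mult_distrib mult_ac)
  from integrable_mult_left[OF this, of "1 / \<eta> ^ k"] assms
  show ?thesis by simp
qed

text \<open>The weight \<open>1/2 + i t\<close> is the factor \<open>s\<close> that stands beside
  zeta in \<open>zeta_halfplane_integral\<close>; on the transformed side it acts as a derivative.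
  Multiplied by \<open>exp (x / 2)\<close>, the value becomes the derivative of
  \<open>exp (x / 2) * exp (- x\<^sup>2 / (2 * \<eta>\<^sup>2))\<close>.\<close>

lemma has_bochner_integral_gauss_iexp_deriv:
  assumes "\<eta> > 0"
  shows "has_bochner_integral lborel
           (\<lambda>t. of_real (\<eta> / sqrt (2 * pi) * exp (- (\<eta> * t)\<^sup>2 / 2)) * (Complex (1/2) t) * iexp (t * x))
           (of_real ((1/2 - x / \<eta>\<^sup>2) * exp (- x\<^sup>2 / (2 * \<eta>\<^sup>2))))"
proof -
  define G where "G t = complex_of_real (exp (- (\<eta> * t)\<^sup>2 / 2)) * iexp (t * x)" for t
  define G' where "G' t = (of_real (- \<eta>\<^sup>2 * t) + \<i> * of_real x) * G t" for t
  have G0: "has_bochner_integral lborel G (of_real (sqrt (2 * pi) / \<eta> * exp (- x\<^sup>2 / (2 * \<eta>\<^sup>2))))"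
    unfolding G_def using has_bochner_integral_gauss_iexp[OF assms] .
  have tG: "integrable lborel (\<lambda>t. of_real t * G t)"
  proof (rule Bochner_Integration.integrable_bound[OF integrable_gauss_moment[OF assms, of 1]])
    show "(\<lambda>t. of_real t * G t) \<in> borel_measurable lborel" unfolding G_def by measurable
  qed (auto simp: G_def norm_mult)
  have "G' = (\<lambda>t. (- of_real (\<eta>\<^sup>2)) * (of_real t * G t) + \<i> * of_real x * G t)"
    by (auto simp: G'_def algebra_simps)
  then have int': "integrable lborel G'"
    and eq': "integral\<^sup>L lborel G' = - of_real (\<eta>\<^sup>2) * (LINT t|lborel. of_real t * G t) + \<i> * of_real x * integral\<^sup>L lborel G"
    using tG G0[THEN integrable.intros] by auto
  have lim: "(G \<longlongrightarrow> 0) at_top" "(G \<longlongrightarrow> 0) at_bot"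
  proof -
    have n: "norm (G t) = exp (- (\<eta> * t)\<^sup>2 / 2)" for t by (simp add: G_def norm_mult)
    have "((\<lambda>t. exp (- (\<eta> * t)\<^sup>2 / 2 :: real)) \<longlongrightarrow> 0) at_top" "((\<lambda>t. exp (- (\<eta> * t)\<^sup>2 / 2 :: real)) \<longlongrightarrow> 0) at_bot"
      using assms by real_asymp+
    then show "(G \<longlongrightarrow> 0) at_top" "(G \<longlongrightarrow> 0) at_bot"
      by (auto intro: tendsto_norm_zero_cancel simp: n)
  qed
  \<comment> \<open>A derivative of a function vanishing at both ends has integral zero; this
    expresses the first moment of \<open>G\<close> through its integral.\<close>
  have "integral\<^sup>L lborel G' = 0 - 0"
  proof (rule integral_deriv_line[OF _ _ int' lim(2) lim(1)])
    show "(G has_vector_derivative G' t) (at t)" for t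
      unfolding G_def G'_def
      by (auto intro!: derivative_eq_intros simp: has_vector_derivative_complex_iff Re_exp Im_exp power2_eq_square algebra_simps)
    show "continuous_on UNIV G'" unfolding G'_def G_def by (intro continuous_intros) auto
  qed
  then have I1: "(LINT t|lborel. of_real t * G t) = \<i> * of_real x * integral\<^sup>L lborel G / of_real (\<eta>\<^sup>2)"
    using eq' assms by (simp add: field_simps)
  have "has_bochner_integral lborel (\<lambda>t. of_real t * G t)
     (\<i> * of_real x * of_real (sqrt (2 * pi) / \<eta> * exp (- x\<^sup>2 / (2 * \<eta>\<^sup>2))) / of_real (\<eta>\<^sup>2))"
    using has_bochner_integral_integrable[OF tG] unfolding I1 has_bochner_integral_integral_eq[OF G0] .
  from has_bochner_integral_add[OF has_bochner_integral_bounded_linear[OF bounded_linear_mult_right[of "of_real (\<eta> / sqrt (2 * pi)) / 2"] G0]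
     has_bochner_integral_bounded_linear[OF bounded_linear_mult_right[of "\<i> * of_real (\<eta> / sqrt (2 * pi))"] this]]
  have "has_bochner_integral lborel
     (\<lambda>t. of_real (\<eta> / sqrt (2 * pi)) / 2 * G t + \<i> * of_real (\<eta> / sqrt (2 * pi)) * (of_real t * G t))
     (of_real (\<eta> / sqrt (2 * pi)) / 2 * of_real (sqrt (2 * pi) / \<eta> * exp (- x\<^sup>2 / (2 * \<eta>\<^sup>2))) +
      \<i> * of_real (\<eta> / sqrt (2 * pi)) * (\<i> * of_real x * of_real (sqrt (2 * pi) / \<eta> * exp (- x\<^sup>2 / (2 * \<eta>\<^sup>2))) / of_real (\<eta>\<^sup>2)))"
    by simp
  moreover have "of_real (\<eta> / sqrt (2 * pi)) / 2 * of_real (sqrt (2 * pi) / \<eta> * exp (- x\<^sup>2 / (2 * \<eta>\<^sup>2))) +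
      \<i> * of_real (\<eta> / sqrt (2 * pi)) * (\<i> * of_real x * of_real (sqrt (2 * pi) / \<eta> * exp (- x\<^sup>2 / (2 * \<eta>\<^sup>2))) / of_real (\<eta>\<^sup>2))
      = complex_of_real ((1/2 - x / \<eta>\<^sup>2) * exp (- x\<^sup>2 / (2 * \<eta>\<^sup>2)))"
    using assms by (simp add: complex_eq_iff field_simps power2_eq_square)
  moreover have "(\<lambda>t. of_real (\<eta> / sqrt (2 * pi)) / 2 * G t + \<i> * of_real (\<eta> / sqrt (2 * pi)) * (of_real t * G t))
     = (\<lambda>t. of_real (\<eta> / sqrt (2 * pi) * exp (- (\<eta> * t)\<^sup>2 / 2)) * (Complex (1/2) t) * iexp (t * x))"
    by (auto simp: G_def Complex_eq algebra_simps add_divide_distrib)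
  ultimately show ?thesis by simp
qed

section \<open>Zeta on the critical line as an integral\<close>

lemma integrable_exp_neg_abs: "integrable lborel (\<lambda>w::real. exp (- \<bar>w\<bar> / 2))"
proof -
  have "has_bochner_integral lborel (\<lambda>w::real. indicator {0..} w *\<^sub>R exp (- \<bar>w\<bar>)) 1"
    using has_bochner_integral_I0i_power_exp_m'[of 0]
    by (rule has_bochner_integral_cong[THEN iffD1, rotated -1]) (auto simp: indicator_def)
  then have "has_bochner_integral lborel (\<lambda>w::real. exp (- \<bar>w\<bar>)) (2 *\<^sub>R 1)"
    by (rule has_bochner_integral_even_function) simp
  then have "integrable lborel (\<lambda>w::real. exp (- \<bar>w\<bar>))"
    by (rule integrable.intros)
  from lborel_integrable_real_affine[OF this, of "1/2" 0] show ?thesis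
    by (simp add: abs_mult)
qed

lemma frac_exp_le: "frac (exp w) * exp (- w / 2) \<le> exp (- \<bar>w\<bar> / 2)" for w :: real
proof (cases "w \<ge> 0")
  case True
  then show ?thesis using frac_lt_1[of "exp w"] by simp
next
  case False
  then have "frac (exp w) = exp w" by (subst frac_eq) auto
  then show ?thesis using False by (simp flip: exp_add)
qed

abbreviation crit :: "real \<Rightarrow> complex" where "crit t \<equiv> Complex (1/2) t"

lemma norm_exp_crit: "norm (exp (- crit t * of_real w)) = exp (- w / 2)"
  by (simp add: norm_exp_eq_Re)

lemma integrable_frac_exp_crit:
  "integrable lborel (\<lambda>w. of_real (frac (exp w)) * exp (- crit t * of_real w))"
proof (rule Bochner_Integration.integrable_bound[OF integrable_exp_neg_abs])
  show "(\<lambda>w. of_real (frac (exp w)) * exp (- crit t * of_real w)) \<in> borel_measurable lborel"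
    unfolding frac_def by measurable
  have "norm (of_real (frac (exp w)) * exp (- crit t * of_real w)) \<le> norm (exp (- \<bar>w\<bar> / 2))" for w
    unfolding norm_mult norm_exp_crit using frac_exp_le[of w] by simp
  then show "AE w in lborel. norm (of_real (frac (exp w)) * exp (- crit t * of_real w)) \<le> norm (exp (- \<bar>w\<bar> / 2))"
    by (rule AE_I2)
qed

text \<open>The coefficient sums of the eta series are the indicator of odd \<open>\<lfloor>v\<rfloor>\<close>.\<close>
lemma odd_floor_conv_frac:
  "2 * frac (v / 2) - frac v = (if odd \<lfloor>v\<rfloor> then 1 else 0)" for v :: real
proof -
  have *: "\<lfloor>v / 2\<rfloor> = \<lfloor>v\<rfloor> div 2"
    by (metis floor_divide_real_eq_div of_int_numeral zero_le_numeral)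
  have "real_of_int k = 2 * real_of_int (k div 2) + real_of_int (k mod 2)" for k
    by (metis mult_div_mod_eq of_int_add of_int_mult of_int_numeral)
  then have "real_of_int \<lfloor>v\<rfloor> = 2 * real_of_int (\<lfloor>v\<rfloor> div 2) + real_of_int (\<lfloor>v\<rfloor> mod 2)" .
  moreover have "real_of_int (\<lfloor>v\<rfloor> mod 2) = (if odd \<lfloor>v\<rfloor> then 1 else 0)"
    by (auto simp: odd_iff_mod_2_eq_one)
  ultimately show ?thesis unfolding frac_def * by simp
qed

lemma has_bochner_integral_exp_crit:
  assumes "a \<le> b"
  shows "has_bochner_integral lborel (\<lambda>w. indicator {a..<b} w *\<^sub>R exp (- crit t * of_real w))
           ((exp (- crit t * of_real a) - exp (- crit t * of_real b)) / crit t)"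
proof -
  have nz: "crit t \<noteq> 0" by (simp add: complex_eq_iff)
  have "has_bochner_integral lborel (\<lambda>w. indicator {a..b} w *\<^sub>R exp (- crit t * of_real w))
     (- exp (- crit t * of_real b) / crit t - (- exp (- crit t * of_real a) / crit t))"
  proof (rule has_bochner_integral_FTC_Icc[OF assms])
    show "((\<lambda>w. - exp (- crit t * of_real w) / crit t) has_vector_derivative exp (- crit t * of_real x)) (at x within {a..b})" for x
    proof -
      have "((\<lambda>z. - exp (- crit t * z) / crit t) has_field_derivative exp (- crit t * of_real x)) (at (of_real x))"
        using nz by (auto intro!: derivative_eq_intros)
      from has_vector_derivative_real_field[OF this] show ?thesis
        by (rule has_vector_derivative_at_within)
    qed
    show "continuous_on {a..b} (\<lambda>x. exp (- crit t * complex_of_real x))"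
      by (intro continuous_intros)
  qed
  then have "has_bochner_integral lborel (\<lambda>w. indicator {a..b} w *\<^sub>R exp (- crit t * of_real w))
     ((exp (- crit t * of_real a) - exp (- crit t * of_real b)) / crit t)"
    by (simp add: field_simps diff_divide_distrib)
  moreover have "AE w in lborel. indicator {a..b} w *\<^sub>R exp (- crit t * of_real w)
      = indicator {a..<b} w *\<^sub>R exp (- crit t * of_real w)"
    using AE_lborel_singleton[of b] by eventually_elim (auto simp: indicator_def)
  ultimately show ?thesis
    by (subst (asm) has_bochner_integral_cong_AE[where g = "\<lambda>w. indicator {a..<b} w *\<^sub>R exp (- crit t * of_real w)"])
       (auto intro!: borel_measurable_continuous_onI continuous_intros)
qed

text \<open>Abel summation with \<open>v = exp w\<close>: the coefficient sum up to \<open>v\<close>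
  is the 0/1-valued function of \<open>odd_floor_conv_frac\<close>, which vanishes for
  \<open>v < 1\<close>. Hence the integral converges absolutely on the critical line, where the
  series converges only conditionally.\<close>

lemma dirichlet_eta_integral:
  "dirichlet_eta (crit t) = crit t *
     (LINT w|lborel. of_real (2 * frac (exp w / 2) - frac (exp w)) * exp (- crit t * of_real w))"
proof -
  define A :: "real \<Rightarrow> real" where "A w = 2 * frac (exp w / 2) - frac (exp w)" for w
  define e where "e w = exp (- crit t * of_real w)" for w :: real
  define l where "l n = ln (real (Suc n))" for n
  define J where "J = (LINT w|lborel. of_real (A w) * e w)"
  have A: "A w = (if odd \<lfloor>exp w\<rfloor> then 1 else 0)" for w
    unfolding A_def by (rule odd_floor_conv_frac)
  have nz: "crit t \<noteq> 0" by (simp add: complex_eq_iff)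
  have A_meas[measurable]: "A \<in> borel_measurable lborel" unfolding A_def frac_def by measurable
  have e_meas[measurable]: "e \<in> borel_measurable lborel" unfolding e_def by measurable
  have Ale: "A w * exp (- w / 2) \<le> exp (- \<bar>w\<bar> / 2)" for w
  proof (cases "w \<ge> 0")
    case False
    then have "\<lfloor>exp w\<rfloor> = 0" by (simp add: floor_eq_iff)
    then show ?thesis by (simp add: A)
  qed (simp add: A)
  have A_nn: "0 \<le> A w" for w by (simp add: A)
  have norm_e: "norm (e w) = exp (- w / 2)" for w unfolding e_def by (rule norm_exp_crit)
  have bound: "norm (indicator S w *\<^sub>R (of_real (A w) * e w)) \<le> exp (- \<bar>w\<bar> / 2)" for S w
    using Ale[of w] A_nn[of w] by (auto simp: norm_mult norm_e indicator_def)
  have int: "integrable lborel (\<lambda>w. indicator S w *\<^sub>R (of_real (A w) * e w))"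
    if "S \<in> sets borel" for S
  proof (rule Bochner_Integration.integrable_bound[OF integrable_exp_neg_abs])
    show "(\<lambda>w. indicator S w *\<^sub>R (of_real (A w) * e w)) \<in> borel_measurable lborel"
      using that by measurable
  qed (use bound in auto)
  \<comment> \<open>Cutting at \<open>l (2 * M) = ln (2 * M + 1)\<close> leaves exactly the
    intervals from \<open>ln (2 * m + 1)\<close> to \<open>ln (2 * m + 2)\<close> with
    \<open>m < M\<close>, on which the floor of \<open>exp w\<close> is odd; each yields two
    consecutive terms of the series.\<close>
  have part: "(LINT w|lborel. indicator {..<l (2 * M)} w *\<^sub>R (of_real (A w) * e w))
      = (\<Sum>m<M. (e (l (2 * m)) - e (l (2 * m + 1))) / crit t)" for M
  proof (induction M)
    case 0
    have "indicator {..<l 0} w *\<^sub>R (of_real (A w) * e w) = 0" for w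
    proof (cases "w < 0")
      case True
      then have "\<lfloor>exp w\<rfloor> = 0" by (simp add: floor_eq_iff)
      then show ?thesis by (simp add: A)
    qed (simp add: l_def)
    then show ?case by (simp only: mult_0_right integral_zero lessThan_0 sum.empty)
  next
    case (Suc M)
    have "indicator {..<l (2 * Suc M)} w *\<^sub>R (of_real (A w) * e w)
      = indicator {..<l (2 * M)} w *\<^sub>R (of_real (A w) * e w) + indicator {l (2 * M)..<l (2 * M + 1)} w *\<^sub>R e w" for w
    proof -
      have *: "w < l n \<longleftrightarrow> exp w < real (Suc n)" "l n \<le> w \<longleftrightarrow> real (Suc n) \<le> exp w" for n
        unfolding l_def by (metis exp_less_cancel_iff exp_ln of_nat_0_less_iff zero_less_Suc)
          (metis exp_le_cancel_iff exp_ln of_nat_0_less_iff zero_less_Suc)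
      consider "exp w < 2 * M + 1" | "2 * M + 1 \<le> exp w" "exp w < 2 * M + 2"
        | "2 * M + 2 \<le> exp w" "exp w < 2 * M + 3" | "2 * M + 3 \<le> exp w" by linarith
      then show ?thesis
      proof cases
        case 2
        then have "\<lfloor>exp w\<rfloor> = 2 * int M + 1" by (simp add: floor_eq_iff)
        with 2 show ?thesis by (simp add: A * indicator_def)
      next
        case 3
        then have "\<lfloor>exp w\<rfloor> = 2 * int M + 2" by (simp add: floor_eq_iff)
        with 3 show ?thesis by (simp add: A * indicator_def)
      qed (auto simp: * indicator_def)
    qed
    moreover have "l (2 * M) \<le> l (2 * M + 1)" by (simp add: l_def)
    ultimately show ?case
      using has_bochner_integral_exp_crit[of "l (2 * M)" "l (2 * M + 1)" t] Suc int[of "{..<l (2 * M)}"]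
      by (simp add: has_bochner_integral_iff e_def)
  qed
  have lim1: "(\<lambda>M. LINT w|lborel. indicator {..<l (2 * M)} w *\<^sub>R (of_real (A w) * e w)) \<longlonglongrightarrow> J"
    unfolding J_def
  proof (rule integral_dominated_convergence[OF _ _ integrable_exp_neg_abs])
    show "AE w in lborel. (\<lambda>M. indicator {..<l (2 * M)} w *\<^sub>R (of_real (A w) * e w)) \<longlonglongrightarrow> of_real (A w) * e w"
    proof (rule AE_I2)
      fix w
      have "filterlim (\<lambda>M. l (2 * M)) at_top sequentially" unfolding l_def by real_asymp
      then have "\<forall>\<^sub>F M in sequentially. w < l (2 * M)" by (auto simp: filterlim_at_top_dense)
      then have "\<forall>\<^sub>F M in sequentially. indicator {..<l (2 * M)} w *\<^sub>R (of_real (A w) * e w) = of_real (A w) * e w"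
        by eventually_elim simp
      then show "(\<lambda>M. indicator {..<l (2 * M)} w *\<^sub>R (of_real (A w) * e w)) \<longlonglongrightarrow> of_real (A w) * e w"
        by (rule tendsto_eventually)
    qed
    show "AE w in lborel. norm (indicator {..<l (2 * M)} w *\<^sub>R (of_real (A w) * e w)) \<le> exp (- \<bar>w\<bar> / 2)" for M
      using bound by (intro AE_I2)
  qed measurable
  define f where "f n = (-1) ^ n / (of_nat (Suc n)) powr crit t" for n
  have f: "f n = (-1) ^ n * e (l n)" for n
  proof -
    have "Ln (of_nat (Suc n)) = of_real (l n)"
      unfolding l_def using Ln_of_real[of "real (Suc n)"] by (simp del: of_nat_Suc)
    then have "(of_nat (Suc n)) powr crit t = exp (crit t * of_real (l n))"
      by (simp add: powr_def del: of_nat_Suc)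
    then show ?thesis
      unfolding f_def e_def by (simp only: exp_minus mult_minus_left divide_inverse)
  qed
  have even: "(\<Sum>n<2 * M. f n) = (\<Sum>m<M. e (l (2 * m)) - e (l (2 * m + 1)))" for M
    by (induction M) (simp_all add: f)
  have lim2: "(\<lambda>M. \<Sum>n<2 * M. f n) \<longlonglongrightarrow> crit t * J"
  proof -
    have "(\<lambda>M. crit t * (LINT w|lborel. indicator {..<l (2 * M)} w *\<^sub>R (of_real (A w) * e w))) \<longlonglongrightarrow> crit t * J"
      by (intro tendsto_intros lim1)
    moreover have "crit t * (LINT w|lborel. indicator {..<l (2 * M)} w *\<^sub>R (of_real (A w) * e w)) = (\<Sum>n<2 * M. f n)" for M
      unfolding part even using nz by (simp add: sum_distrib_left)
    ultimately show ?thesis by simp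
  qed
  \<comment> \<open>Odd partial sums differ from even ones by a single term, of norm
    \<open>1 / sqrt (2 * M + 1)\<close>.\<close>
  have "(\<lambda>M. e (l (2 * M))) \<longlonglongrightarrow> 0"
  proof (rule tendsto_norm_zero_cancel)
    show "(\<lambda>M. norm (e (l (2 * M)))) \<longlonglongrightarrow> 0"
      unfolding norm_e l_def by real_asymp
  qed
  from tendsto_add[OF lim2 this] have "(\<lambda>M. \<Sum>n<2 * M + 1. f n) \<longlonglongrightarrow> crit t * J"
    by (simp add: f)
  with lim2 have "(\<lambda>n. \<Sum>i<n. f i) \<longlonglongrightarrow> crit t * J"
    by (rule limseq_even_odd)
  then have "f sums (crit t * J)" by (simp add: sums_def)
  then have "suminf f = crit t * J" by (rule sums_unique[symmetric])
  then show ?thesis unfolding dirichlet_eta_def f_def J_def A_def e_def .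
qed

text \<open>With I for the integral, a translation by \<open>ln 2\<close> replaces
  \<open>frac (exp w)\<close> by \<open>frac (exp w / 2)\<close>, so the eta integral is
  \<open>(2^(1-s) - 1) I\<close> and the factor relating eta to zeta cancels. The usual pole term
  s/(s-1) is absorbed by the range \<open>exp w < 1\<close>, where the fractional part is
  \<open>exp w\<close> itself.\<close>

lemma zeta_halfplane_integral:
  "zeta_halfplane (crit t) = - crit t * (LINT w|lborel. of_real (frac (exp w)) * exp (- crit t * of_real w))"
proof -
  define I where "I = (LINT w|lborel. of_real (frac (exp w)) * exp (- crit t * of_real w))"
  define q where "q = exp (- crit t * of_real (ln 2))"
  have int: "integrable lborel (\<lambda>w. of_real (frac (exp w)) * exp (- crit t * of_real w))"
    by (rule integrable_frac_exp_crit)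
  have shift: "of_real (frac (exp (- ln 2 + 1 * w))) * exp (- crit t * of_real (- ln 2 + 1 * w))
     = of_real (frac (exp w / 2)) * exp (- crit t * of_real w) / q" for w
  proof -
    have "exp (- ln 2 + 1 * w) = exp w / 2" by (simp add: exp_diff)
    moreover have "- crit t * of_real (- ln 2 + 1 * w) = - crit t * of_real w - - crit t * of_real (ln 2)"
      by (simp add: algebra_simps)
    ultimately show ?thesis by (simp only: exp_diff q_def times_divide_eq_right)
  qed
  have "has_bochner_integral lborel (\<lambda>w. of_real (frac (exp w / 2)) * exp (- crit t * of_real w) / q) I"
    using lborel_has_bochner_integral_real_affine_iff[THEN iffD1, OF _ has_bochner_integral_integrable[OF int], of 1 "- ln 2"]
    unfolding shift I_def by simp
  from has_bochner_integral_bounded_linear[OF bounded_linear_mult_right[of "2 * q"] this]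
  have "has_bochner_integral lborel (\<lambda>w. 2 * (of_real (frac (exp w / 2)) * exp (- crit t * of_real w))) (2 * q * I)"
    by (simp add: q_def)
  from has_bochner_integral_diff[OF this has_bochner_integral_integrable[OF int]]
  have "has_bochner_integral lborel
     (\<lambda>w. of_real (2 * frac (exp w / 2) - frac (exp w)) * exp (- crit t * of_real w)) (2 * q * I - I)"
    by (simp add: I_def algebra_simps)
  then have eta: "dirichlet_eta (crit t) = crit t * (2 * q * I - I)"
    unfolding dirichlet_eta_integral by (simp add: has_bochner_integral_iff)
  have q: "2 powr (1 - crit t) = 2 * q"
  proof -
    have "Ln 2 = of_real (ln 2)" using Ln_of_real[of 2] by simp
    then have "2 powr (1 - crit t) = exp (of_real (ln 2) + - crit t * of_real (ln 2))"
      by (simp add: powr_def algebra_simps)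
    also have "\<dots> = 2 * q"
      unfolding exp_add q_def exp_of_real by simp
    finally show ?thesis .
  qed
  have "norm (2 * q) = 2 * exp (- ln 2 / 2)" unfolding q_def norm_mult norm_exp_crit by simp
  \<comment> \<open>The number \<open>2 * q = 2^(1-s)\<close> has norm \<open>sqrt 2\<close>, so the
    divisor \<open>1 - 2^(1-s)\<close> has no zero on the critical line.\<close>
  moreover have "2 * exp (- ln 2 / 2) \<noteq> (1::real)"
  proof
    assume "2 * exp (- ln 2 / 2) = (1::real)"
    moreover have "exp (ln 2 + - ln 2 / 2) = 2 * exp (- ln 2 / 2 :: real)"
      by (subst exp_add) simp
    ultimately have "ln 2 + - ln 2 / 2 = (0::real)" by (metis exp_eq_one_iff)
    then show False by simp
  qed
  ultimately have nz: "1 - 2 * q \<noteq> 0" by (metis norm_one right_minus_eq)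
  show ?thesis
    unfolding zeta_halfplane_def q eta I_def[symmetric] using nz by (simp add: divide_simps) (simp add: algebra_simps)
qed

section \<open>Muentz' formula for a Gaussian\<close>

text \<open>Completing the square absorbs the exponential into half of the Gaussian; the other half,
  a Gaussian with parameter \<open>\<theta>\<close>, still has all moments.\<close>

lemma integrable_exp_gauss:
  assumes "\<eta> > 0"
  shows "integrable lborel (\<lambda>x::real. exp (a * x) * \<bar>x\<bar> ^ k * exp (- x\<^sup>2 / (2 * \<eta>\<^sup>2)))"
proof -
  define \<theta> where "\<theta> = 1 / (sqrt 2 * \<eta>)"
  have \<theta>: "\<theta> > 0" and \<theta>2: "\<theta>\<^sup>2 = 1 / (2 * \<eta>\<^sup>2)"
    using assms by (simp_all add: \<theta>_def power_divide power_mult_distrib)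
  show ?thesis
  proof (rule Bochner_Integration.integrable_bound[OF integrable_mult_right[OF integrable_gauss_moment[OF \<theta>, of k], of "exp (a\<^sup>2 * \<eta>\<^sup>2)"]])
    show "(\<lambda>x::real. exp (a * x) * \<bar>x\<bar> ^ k * exp (- x\<^sup>2 / (2 * \<eta>\<^sup>2))) \<in> borel_measurable lborel"
      by measurable
    have "norm (exp (a * x) * \<bar>x\<bar> ^ k * exp (- x\<^sup>2 / (2 * \<eta>\<^sup>2)))
       \<le> norm (exp (a\<^sup>2 * \<eta>\<^sup>2) * (exp (- (\<theta> * x)\<^sup>2 / 2) * \<bar>x\<bar> ^ k))" for x
    proof -
      have "0 \<le> (a * \<eta> - x / (2 * \<eta>))\<^sup>2" by simp
      also have "\<dots> = a\<^sup>2 * \<eta>\<^sup>2 - a * x + x\<^sup>2 / (4 * \<eta>\<^sup>2)"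
        using assms by (simp add: power2_diff power_mult_distrib power_divide)
      finally have "a * x + - x\<^sup>2 / (2 * \<eta>\<^sup>2) \<le> a\<^sup>2 * \<eta>\<^sup>2 + - x\<^sup>2 / (4 * \<eta>\<^sup>2)"
        by simp
      then have "exp (a * x) * exp (- x\<^sup>2 / (2 * \<eta>\<^sup>2)) \<le> exp (a\<^sup>2 * \<eta>\<^sup>2) * exp (- x\<^sup>2 / (4 * \<eta>\<^sup>2))"
        by (simp only: flip: exp_add) simp
      moreover have "- (\<theta> * x)\<^sup>2 / 2 = - x\<^sup>2 / (4 * \<eta>\<^sup>2)"
        by (simp add: power_mult_distrib \<theta>2)
      ultimately have "(exp (a * x) * exp (- x\<^sup>2 / (2 * \<eta>\<^sup>2))) * \<bar>x\<bar> ^ k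
         \<le> (exp (a\<^sup>2 * \<eta>\<^sup>2) * exp (- (\<theta> * x)\<^sup>2 / 2)) * \<bar>x\<bar> ^ k"
        by (intro mult_right_mono) (simp_all only: zero_le_power abs_ge_zero)
      then show ?thesis by (simp add: abs_mult mult_ac)
    qed
    then show "AE x in lborel. norm (exp (a * x) * \<bar>x\<bar> ^ k * exp (- x\<^sup>2 / (2 * \<eta>\<^sup>2)))
       \<le> norm (exp (a\<^sup>2 * \<eta>\<^sup>2) * (exp (- (\<theta> * x)\<^sup>2 / 2) * \<bar>x\<bar> ^ k))"
      by (rule AE_I2)
  qed
qed

lemma has_bochner_integral_exp_half_gauss:
  assumes "\<eta> > 0"
  shows "has_bochner_integral lborel (\<lambda>x. exp (- x / 2) * exp (- x\<^sup>2 / (2 * \<eta>\<^sup>2)))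
           (\<eta> * sqrt (2 * pi) * exp (\<eta>\<^sup>2 / 8))"
proof -
  have "has_bochner_integral lborel (\<lambda>x. exp (- (1 / \<eta> * (\<eta>\<^sup>2 / 2 + 1 * x))\<^sup>2 / 2)) (sqrt (2 * pi) / (1 / \<eta>))"
    using lborel_has_bochner_integral_real_affine_iff[THEN iffD1, OF _ has_bochner_integral_gauss, of 1 "1 / \<eta>" "\<eta>\<^sup>2 / 2"] assms
    by simp
  from has_bochner_integral_mult_right[OF this, of "exp (\<eta>\<^sup>2 / 8)"]
  have "has_bochner_integral lborel (\<lambda>x. exp (\<eta>\<^sup>2 / 8) * exp (- (1 / \<eta> * (\<eta>\<^sup>2 / 2 + 1 * x))\<^sup>2 / 2))
     (\<eta> * sqrt (2 * pi) * exp (\<eta>\<^sup>2 / 8))" by (simp add: mult_ac)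
  moreover have "exp (\<eta>\<^sup>2 / 8) * exp (- (1 / \<eta> * (\<eta>\<^sup>2 / 2 + 1 * x))\<^sup>2 / 2)
    = exp (- x / 2) * exp (- x\<^sup>2 / (2 * \<eta>\<^sup>2))" for x
  proof -
    have "(1 / \<eta> * (\<eta>\<^sup>2 / 2 + 1 * x))\<^sup>2 = \<eta>\<^sup>2 / 4 + x + x\<^sup>2 / \<eta>\<^sup>2"
      using assms by (simp add: power2_eq_square field_simps)
    then have "\<eta>\<^sup>2 / 8 + - (1 / \<eta> * (\<eta>\<^sup>2 / 2 + 1 * x))\<^sup>2 / 2 = - x / 2 + - x\<^sup>2 / (2 * \<eta>\<^sup>2)"
      by (simp add: field_simps)
    then show ?thesis by (simp only: flip: exp_add)
  qed
  ultimately show ?thesis by simp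
qed

text \<open>The factor \<open>exp (x / 2)\<close> is what moves the Mellin transform of the Gaussian to the line \<open>Re s = 1/2\<close>.\<close>
definition gker :: "real \<Rightarrow> real \<Rightarrow> real" where
  "gker \<eta> x = exp (x / 2) * exp (- x\<^sup>2 / (2 * \<eta>\<^sup>2))"

definition gker' :: "real \<Rightarrow> real \<Rightarrow> real" where
  "gker' \<eta> x = (1/2 - x / \<eta>\<^sup>2) * gker \<eta> x"

lemma gker_deriv:
  assumes "\<eta> > 0" shows "(gker \<eta> has_real_derivative gker' \<eta> x) (at x)"
  unfolding gker_def[abs_def] gker'_def using assms
  by (auto intro!: derivative_eq_intros simp: field_simps power2_eq_square)

lemma gker_measurable[measurable]: "gker \<eta> \<in> borel_measurable borel" "gker' \<eta> \<in> borel_measurable borel"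
  unfolding gker_def[abs_def] gker'_def[abs_def] by measurable

lemma gker_continuous: "\<eta> > 0 \<Longrightarrow> continuous_on S (gker \<eta>)" "\<eta> > 0 \<Longrightarrow> continuous_on S (gker' \<eta>)"
  unfolding gker_def[abs_def] gker'_def[abs_def] by (auto intro!: continuous_intros)

text \<open>Three exponents are needed: \<open>a = 0\<close> for tail integrals of
  \<open>gker'\<close>, \<open>a = 1\<close> for the mean, and \<open>a = 2\<close> for dominating a
  sum over all positive integers.\<close>

lemma integrable_exp_gker:
  assumes "\<eta> > 0"
  shows "integrable lborel (\<lambda>w. exp (a * w) * gker \<eta> (y - w))"
    and "integrable lborel (\<lambda>w. exp (a * w) * gker' \<eta> (y - w))"
proof -
  have 0: "integrable lborel (\<lambda>x. exp (a * (y - x)) * gker \<eta> x)"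
    using integrable_mult_right[OF integrable_exp_gauss[OF assms, of "1/2 - a" 0], of "exp (a * y)"]
    by (simp add: gker_def algebra_simps flip: exp_add)
  have 1: "integrable lborel (\<lambda>x. exp (a * (y - x)) * (x * gker \<eta> x))"
  proof (rule Bochner_Integration.integrable_bound)
    show "integrable lborel (\<lambda>x. exp (a * y) * (exp ((1/2 - a) * x) * \<bar>x\<bar> ^ 1 * exp (- x\<^sup>2 / (2 * \<eta>\<^sup>2))))"
      by (intro integrable_mult_right integrable_exp_gauss assms)
    show "AE x in lborel. norm (exp (a * (y - x)) * (x * gker \<eta> x))
      \<le> norm (exp (a * y) * (exp ((1/2 - a) * x) * \<bar>x\<bar> ^ 1 * exp (- x\<^sup>2 / (2 * \<eta>\<^sup>2))))"
      by (intro AE_I2) (simp add: gker_def abs_mult algebra_simps exp_add exp_diff)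
  qed measurable
  have "integrable lborel (\<lambda>x. exp (a * (y - x)) * gker \<eta> x * (1/2) - exp (a * (y - x)) * (x * gker \<eta> x) * (1 / \<eta>\<^sup>2))"
    using 0 1 by (intro Bochner_Integration.integrable_diff integrable_mult_left) auto
  then have 2: "integrable lborel (\<lambda>x. exp (a * (y - x)) * gker' \<eta> x)"
    by (simp add: gker'_def algebra_simps)
  show "integrable lborel (\<lambda>w. exp (a * w) * gker \<eta> (y - w))"
    using lborel_integrable_real_affine[OF 0, of "-1" y] by simp
  show "integrable lborel (\<lambda>w. exp (a * w) * gker' \<eta> (y - w))"
    using lborel_integrable_real_affine[OF 2, of "-1" y] by simp
qed

lemma gker_tendsto_0:
  assumes "\<eta> > 0"
  shows "((\<lambda>w. exp (a * w) * gker \<eta> (y - w)) \<longlongrightarrow> 0) at_top" "((\<lambda>w. exp (a * w) * gker \<eta> (y - w)) \<longlongrightarrow> 0) at_bot"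
proof -
  have *: "exp (a * w) * gker \<eta> (y - w) = exp (a * w + (y - w) / 2 + - (y - w)\<^sup>2 / (2 * \<eta>\<^sup>2))" for w
    by (simp only: gker_def exp_add mult.assoc)
  show "((\<lambda>w. exp (a * w) * gker \<eta> (y - w)) \<longlongrightarrow> 0) at_top"
    unfolding * using assms by real_asymp
  show "((\<lambda>w. exp (a * w) * gker \<eta> (y - w)) \<longlongrightarrow> 0) at_bot"
    unfolding * using assms by real_asymp
qed

lemma integral_exp_gker:
  assumes "\<eta> > 0"
  shows "(LINT w|lborel. exp w * gker \<eta> (y - w)) = exp y * (\<eta> * sqrt (2 * pi) * exp (\<eta>\<^sup>2 / 8))"
proof -
  have "has_bochner_integral lborel (\<lambda>w. exp (- (y + (-1) * w) / 2) * exp (- (y + (-1) * w)\<^sup>2 / (2 * \<eta>\<^sup>2)))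
          (\<eta> * sqrt (2 * pi) * exp (\<eta>\<^sup>2 / 8))"
    using lborel_has_bochner_integral_real_affine_iff[THEN iffD1, OF _ has_bochner_integral_exp_half_gauss[OF assms], of "-1" y]
    by simp
  from has_bochner_integral_mult_right[OF this, of "exp y"]
  have "has_bochner_integral lborel (\<lambda>w. exp y * (exp (- (y - w) / 2) * exp (- (y - w)\<^sup>2 / (2 * \<eta>\<^sup>2))))
          (exp y * (\<eta> * sqrt (2 * pi) * exp (\<eta>\<^sup>2 / 8)))" by simp
  moreover have "exp y * (exp (- (y - w) / 2) * exp (- (y - w)\<^sup>2 / (2 * \<eta>\<^sup>2))) = exp w * gker \<eta> (y - w)" for w
    unfolding gker_def mult.assoc[symmetric] by (simp add: field_simps flip: exp_add)
  ultimately show ?thesis by (simp only: has_bochner_integral_integral_eq)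
qed

text \<open>Integration by parts: \<open>exp w * gker \<eta> (y - w)\<close> vanishes at both ends
  and has derivative \<open>exp w * gker \<eta> (y - w) - exp w * gker' \<eta> (y - w)\<close>, so
  the kernel and its derivative have the same integral against \<open>exp w\<close>.\<close>

lemma integral_exp_gker':
  assumes "\<eta> > 0"
  shows "(LINT w|lborel. exp w * gker' \<eta> (y - w)) = exp y * (\<eta> * sqrt (2 * pi) * exp (\<eta>\<^sup>2 / 8))"
proof -
  have int: "integrable lborel (\<lambda>w. exp w * gker \<eta> (y - w))" "integrable lborel (\<lambda>w. exp w * gker' \<eta> (y - w))"
    using integrable_exp_gker[OF assms, of 1] by simp_all
  have "(LINT w|lborel. exp w * gker \<eta> (y - w) - exp w * gker' \<eta> (y - w)) = 0 - 0"
  proof (rule integral_deriv_line)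
    show "((\<lambda>w. exp w * gker \<eta> (y - w)) has_vector_derivative exp x * gker \<eta> (y - x) - exp x * gker' \<eta> (y - x)) (at x)" for x
      unfolding has_real_derivative_iff_has_vector_derivative[symmetric]
      by (rule derivative_eq_intros DERIV_chain2[OF gker_deriv[OF assms]] refl)+ simp
    show "continuous_on UNIV (\<lambda>x. exp x * gker \<eta> (y - x) - exp x * gker' \<eta> (y - x))"
      using assms by (auto intro!: continuous_intros continuous_on_compose2[OF gker_continuous(1)] continuous_on_compose2[OF gker_continuous(2)])
    show "integrable lborel (\<lambda>x. exp x * gker \<eta> (y - x) - exp x * gker' \<eta> (y - x))"
      using int by simp
    show "((\<lambda>w. exp w * gker \<eta> (y - w)) \<longlongrightarrow> 0) at_bot" "((\<lambda>w. exp w * gker \<eta> (y - w)) \<longlongrightarrow> 0) at_top"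
      using gker_tendsto_0[OF assms, of 1] by simp_all
  qed
  then show ?thesis using int integral_exp_gker[OF assms, of y] by simp
qed

text \<open>The floor of \<open>exp w\<close> counts the \<open>j\<close> with
  \<open>ln (Suc j) \<le> w\<close>, and integrating \<open>gker' \<eta> (y - w)\<close> over
  \<open>w > ln (Suc j)\<close> gives \<open>gker \<eta> (y - ln (Suc j))\<close>. The work lies in
  exchanging sum and integral.\<close>

lemma integral_floor_gker':
  assumes "\<eta> > 0"
  shows "(\<lambda>j. gker \<eta> (y - ln (Suc j))) sums (LINT w|lborel. real_of_int \<lfloor>exp w\<rfloor> * gker' \<eta> (y - w))"
proof -
  define f where "f j w = indicator {ln (real (Suc j))<..} w * gker' \<eta> (y - w)" for j w
  define B where "B = (LINT w|lborel. norm (exp (2 * w) * gker' \<eta> (y - w)))"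
  have int: "integrable lborel (\<lambda>w. gker' \<eta> (y - w))"
    using integrable_exp_gker(2)[OF assms, of 0] by simp
  have intf: "integrable lborel (f j)" for j
    unfolding f_def by (rule integrable_real_mult_indicator[OF _ int, simplified mult.commute]) simp
  have sum: "f j w = 0" if "j \<notin> {j. real (Suc j) < exp w}" for j w
  proof -
    have "\<not> ln (real (Suc j)) < w"
      using that by (metis exp_less_cancel_iff exp_ln mem_Collect_eq of_nat_0_less_iff zero_less_Suc)
    then show ?thesis by (simp add: f_def)
  qed
  have fin: "finite {j. real (Suc j) < exp w}" for w
    by (rule finite_subset[of _ "{..nat \<lceil>exp w\<rceil>}"]) (auto, linarith)
  have "(\<lambda>j. integral\<^sup>L lborel (f j)) sums (LINT w|lborel. (\<Sum>j. f j w))"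
  proof (rule sums_integral[OF intf])
    show "AE w in lborel. summable (\<lambda>j. norm (f j w))"
      by (intro AE_I2 summable_finite[OF fin]) (use sum in auto)
    have "norm (LINT w|lborel. norm (f j w)) \<le> B * (1 / real (Suc j) ^ 2)" for j
    proof -
      \<comment> \<open>On the support of \<open>f j\<close> one has
        \<open>Suc j \<le> exp w\<close>, so the factor \<open>exp (2 * w)\<close> pays for the
        summable weight \<open>1 / (Suc j)^2\<close>.\<close>
      have "norm (f j w) \<le> norm (exp (2 * w) * gker' \<eta> (y - w)) * (1 / real (Suc j) ^ 2)" for w
      proof (cases "ln (real (Suc j)) < w")
        case True
        then have "real (Suc j) \<le> exp w"
          by (metis exp_ln exp_le_cancel_iff less_eq_real_def of_nat_0_less_iff zero_less_Suc)
        then have "real (Suc j) ^ 2 \<le> exp w ^ 2" by (intro power_mono) auto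
        then have "1 \<le> exp (2 * w) * (1 / real (Suc j) ^ 2)"
          by (simp add: exp_double del: of_nat_Suc)
        from mult_right_mono[OF this, of "norm (gker' \<eta> (y - w))"] True show ?thesis
          by (simp add: f_def abs_mult mult_ac)
      qed (simp add: f_def)
      then have "(LINT w|lborel. norm (f j w)) \<le> (LINT w|lborel. norm (exp (2 * w) * gker' \<eta> (y - w)) * (1 / real (Suc j) ^ 2))"
        using intf integrable_exp_gker(2)[OF assms, of 2]
        by (intro integral_mono integrable_norm integrable_mult_left) auto
      then show ?thesis by (simp add: B_def)
    qed
    moreover have "summable (\<lambda>j. B * (1 / real (Suc j) ^ 2))"
      by (intro summable_mult) (use inverse_power_summable[of 2, where 'a = real] in \<open>subst summable_Suc_iff[of "\<lambda>n. 1 / real n ^ 2"], simp add: field_simps\<close>)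
    ultimately show "summable (\<lambda>j. LINT w|lborel. norm (f j w))"
      by (rule summable_comparison_test'[rotated])
  qed
  moreover have "integral\<^sup>L lborel (f j) = gker \<eta> (y - ln (Suc j))" for j
  proof -
    have "(LINT w|lborel. indicator {ln (real (Suc j))<..} w *\<^sub>R gker' \<eta> (y - w)) = 0 - (- gker \<eta> (y - ln (real (Suc j))))"
    proof (rule integral_deriv_half_line[OF _ _ int])
      show "((\<lambda>w. - gker \<eta> (y - w)) has_vector_derivative gker' \<eta> (y - x)) (at x)" for x
        unfolding has_real_derivative_iff_has_vector_derivative[symmetric]
        by (rule derivative_eq_intros DERIV_chain2[OF gker_deriv[OF assms]] refl)+ simp
      show "continuous_on UNIV (\<lambda>x. gker' \<eta> (y - x))"
        using assms by (auto intro!: continuous_intros continuous_on_compose2[OF gker_continuous(2)])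
      show "((\<lambda>w. - gker \<eta> (y - w)) \<longlongrightarrow> 0) at_top"
        using tendsto_minus[OF gker_tendsto_0(1)[OF assms, of 0 y]] by simp
    qed
    then show ?thesis by (simp add: f_def[abs_def])
  qed
  moreover have "(LINT w|lborel. (\<Sum>j. f j w)) = (LINT w|lborel. real_of_int \<lfloor>exp w\<rfloor> * gker' \<eta> (y - w))"
  proof (rule integral_cong_AE)
    \<comment> \<open>The half-lines in \<open>f\<close> are open, while the floor jumps at their
      end points; the two integrands can disagree only on this countable set.\<close>
    have "AE w in lborel. w \<notin> range (\<lambda>j. ln (real (Suc j)))"
      by (intro AE_not_in countable_imp_null_set_lborel) auto
    then show "AE w in lborel. (\<Sum>j. f j w) = real_of_int \<lfloor>exp w\<rfloor> * gker' \<eta> (y - w)"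
    proof eventually_elim
      case (elim w)
      have *: "ln (real (Suc j)) < w \<longleftrightarrow> real (Suc j) \<le> exp w" for j
        using elim by (metis exp_ln exp_le_cancel_iff exp_less_cancel_iff less_eq_real_def of_nat_0_less_iff rangeI zero_less_Suc)
      have "(\<Sum>j. f j w) = (\<Sum>j<nat \<lfloor>exp w\<rfloor>. f j w)"
      proof (rule suminf_finite)
        fix j assume "j \<notin> {..<nat \<lfloor>exp w\<rfloor>}"
        then have "\<not> real (Suc j) \<le> exp w" by (simp add: not_le) linarith
        then show "f j w = 0" using * by (simp add: f_def)
      qed simp
      also have "\<dots> = (\<Sum>j<nat \<lfloor>exp w\<rfloor>. gker' \<eta> (y - w))"
      proof (rule sum.cong)
        fix j assume "j \<in> {..<nat \<lfloor>exp w\<rfloor>}"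
        then have "real (Suc j) \<le> exp w" by simp linarith
        then show "f j w = gker' \<eta> (y - w)" using * by (simp add: f_def)
      qed simp
      finally show ?case by simp
    qed
    show "(\<lambda>w. \<Sum>j. f j w) \<in> borel_measurable lborel"
      using intf by (intro borel_measurable_suminf) auto
  qed measurable
  ultimately show ?thesis by simp
qed


lemma integral_frac_gker':
  assumes "\<eta> > 0"
  shows "(LINT w|lborel. frac (exp w) * gker' \<eta> (y - w))
     = exp y * (\<eta> * sqrt (2 * pi) * exp (\<eta>\<^sup>2 / 8)) - (\<Sum>j. gker \<eta> (y - ln (Suc j)))"
proof -
  have int: "integrable lborel (\<lambda>w. exp w * gker' \<eta> (y - w))"
    using integrable_exp_gker(2)[OF assms, of 1] by simp
  have "integrable lborel (\<lambda>w. real_of_int \<lfloor>exp w\<rfloor> * gker' \<eta> (y - w))"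
  proof (rule Bochner_Integration.integrable_bound[OF int])
    show "AE w in lborel. norm (real_of_int \<lfloor>exp w\<rfloor> * gker' \<eta> (y - w)) \<le> norm (exp w * gker' \<eta> (y - w))"
      by (intro AE_I2) (auto simp: abs_mult intro!: mult_right_mono)
  qed measurable
  then show ?thesis
    using int integral_exp_gker'[OF assms, of y] sums_unique[OF integral_floor_gker'[OF assms, of y]]
    by (simp add: frac_def left_diff_distrib)
qed

text \<open>Normalised so that the integral of \<open>psi \<eta> t * iexp (t * x)\<close> over
  \<open>t\<close> is \<open>exp (- x\<^sup>2 / (2 * \<eta>\<^sup>2))\<close>, the Gaussian of width
  \<open>\<eta>\<close> and height 1.\<close>

definition psi :: "real \<Rightarrow> real \<Rightarrow> real" where
  "psi \<eta> t = \<eta> / sqrt (2 * pi) * exp (- (\<eta> * t)\<^sup>2 / 2)"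

lemma psi_measurable[measurable]: "psi \<eta> \<in> borel_measurable borel"
  unfolding psi_def[abs_def] by measurable

lemma psi_nonneg: "\<eta> > 0 \<Longrightarrow> 0 \<le> psi \<eta> t"
  by (simp add: psi_def)

lemma crit_measurable[measurable]: "crit \<in> borel_measurable borel"
  unfolding Complex_eq by measurable

lemma zeta_halfplane_measurable[measurable]: "(\<lambda>t. zeta_halfplane (crit t)) \<in> borel_measurable borel"
proof -
  have "(\<lambda>(t, w). complex_of_real (frac (exp w)) * exp (- crit t * of_real w)) \<in> borel_measurable (borel \<Otimes>\<^sub>M lborel)"
    unfolding frac_def by measurable
  then have "(\<lambda>t. LINT w|lborel. complex_of_real (frac (exp w)) * exp (- crit t * of_real w)) \<in> borel_measurable borel"
    by (rule lborel.borel_measurable_lebesgue_integral)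
  then show ?thesis unfolding zeta_halfplane_integral by measurable
qed

lemma integrable_psi_crit:
  assumes "\<eta> > 0" shows "integrable lborel (\<lambda>t. psi \<eta> t * norm (crit t))"
proof (rule Bochner_Integration.integrable_bound)
  show "integrable lborel (\<lambda>t. \<eta> / sqrt (2 * pi) * (exp (- (\<eta> * t)\<^sup>2 / 2) * \<bar>t\<bar> ^ 0 + exp (- (\<eta> * t)\<^sup>2 / 2) * \<bar>t\<bar> ^ 1))"
    by (intro integrable_mult_right Bochner_Integration.integrable_add integrable_gauss_moment assms)
  have "norm (psi \<eta> t * norm (crit t)) \<le>
     norm (\<eta> / sqrt (2 * pi) * (exp (- (\<eta> * t)\<^sup>2 / 2) * \<bar>t\<bar> ^ 0 + exp (- (\<eta> * t)\<^sup>2 / 2) * \<bar>t\<bar> ^ 1))" for t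
  proof -
    have "norm (crit t) \<le> 1 + \<bar>t\<bar>"
      using cmod_le[of "crit t"] by simp
    then have "psi \<eta> t * norm (crit t) \<le> psi \<eta> t * (1 + \<bar>t\<bar>)"
      using assms by (intro mult_left_mono) (auto simp: psi_def)
    also have "\<dots> = \<eta> / sqrt (2 * pi) * (exp (- (\<eta> * t)\<^sup>2 / 2) * \<bar>t\<bar> ^ 0 + exp (- (\<eta> * t)\<^sup>2 / 2) * \<bar>t\<bar> ^ 1)"
      by (simp add: psi_def distrib_left)
    finally show ?thesis
      using assms by (simp add: psi_def)
  qed
  then show "AE t in lborel. norm (psi \<eta> t * norm (crit t)) \<le>
     norm (\<eta> / sqrt (2 * pi) * (exp (- (\<eta> * t)\<^sup>2 / 2) * \<bar>t\<bar> ^ 0 + exp (- (\<eta> * t)\<^sup>2 / 2) * \<bar>t\<bar> ^ 1))"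
    by (rule AE_I2)
qed measurable

text \<open>Zeta is replaced by its fractional part integral and the order of integration is
  exchanged. The inner integral over \<open>t\<close> is the Gaussian with weight
  \<open>1/2 + i t\<close>, so it produces \<open>gker'\<close>. Splitting the fractional part then
  gives the mean and the sum over integers, and the minus sign in front of the zeta integral turns
  mean minus sum into sum minus mean. The prefactor \<open>exp (- y / 2)\<close> is the trace of Re
  s = 1/2.\<close>

lemma muntz_formula:
  assumes "\<eta> > 0"
  shows "(LINT t|lborel. of_real (psi \<eta> t) * iexp (t * y) * zeta_halfplane (crit t))
     = of_real (exp (- y / 2) * ((\<Sum>j. gker \<eta> (y - ln (Suc j))) - exp y * (\<eta> * sqrt (2 * pi) * exp (\<eta>\<^sup>2 / 8))))"
proof -
  define f where "f t w = of_real (psi \<eta> t) * iexp (t * y) * crit t * (of_real (frac (exp w)) * exp (- crit t * of_real w))" for t w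
  have f_meas[measurable]: "case_prod f \<in> borel_measurable (borel \<Otimes>\<^sub>M borel)"
    unfolding f_def[abs_def] frac_def by measurable
  have norm_f: "norm (f t w) = psi \<eta> t * norm (crit t) * (frac (exp w) * exp (- w / 2))" for t w
    unfolding f_def norm_mult norm_exp_crit using psi_nonneg[OF assms, of t] by simp
  have "integrable (lborel \<Otimes>\<^sub>M lborel) (case_prod f)"
  proof (rule lborel_pair.Fubini_integrable)
    show "case_prod f \<in> borel_measurable (lborel \<Otimes>\<^sub>M lborel)" by measurable
    show "integrable lborel (\<lambda>x. LINT y|lborel. norm (case_prod f (x, y)))"
      unfolding prod.case norm_f using integrable_psi_crit[OF assms] by simp
    show "AE x in lborel. integrable lborel (\<lambda>y. case_prod f (x, y))"
      unfolding prod.case f_def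
      by (intro AE_I2 integrable_mult_right integrable_frac_exp_crit)
  qed
  from lborel_pair.Fubini_integral[OF this]
  have fub: "(LINT t|lborel. LINT w|lborel. f t w) = (LINT w|lborel. LINT t|lborel. f t w)" ..
  have "of_real (psi \<eta> t) * iexp (t * y) * zeta_halfplane (crit t) = - (LINT w|lborel. f t w)" for t
    unfolding zeta_halfplane_integral f_def by (subst integral_mult_right_zero) (simp add: mult_ac)
  moreover have "(LINT t|lborel. f t w) = of_real (exp (- y / 2) * (frac (exp w) * gker' \<eta> (y - w)))" for w
  proof -
    have "f t w = of_real (frac (exp w) * exp (- w / 2)) *
      (of_real (\<eta> / sqrt (2 * pi) * exp (- (\<eta> * t)\<^sup>2 / 2)) * crit t * iexp (t * (y - w)))" for t
    proof -
      have "- crit t * of_real w = of_real (- w / 2) + - \<i> * of_real (t * w)" by (simp add: complex_eq_iff)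
      then have "exp (- crit t * of_real w) = of_real (exp (- w / 2)) * exp (- \<i> * of_real (t * w))"
        by (simp only: exp_add exp_of_real)
      moreover have "iexp (t * (y - w)) = iexp (t * y) * exp (- \<i> * of_real (t * w))"
        by (simp add: algebra_simps flip: exp_add)
      ultimately show ?thesis unfolding f_def psi_def by (simp add: mult_ac)
    qed
    then have "(LINT t|lborel. f t w) = of_real (frac (exp w) * exp (- w / 2)) *
       of_real ((1/2 - (y - w) / \<eta>\<^sup>2) * exp (- (y - w)\<^sup>2 / (2 * \<eta>\<^sup>2)))"
      using has_bochner_integral_integral_eq[OF has_bochner_integral_gauss_iexp_deriv[OF assms, of "y - w"]]
      by (simp only: integral_mult_right_zero)
    moreover have "exp (- w / 2) = exp (- y / 2) * exp ((y - w) / 2)"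
      by (simp add: field_simps flip: exp_add)
    ultimately show ?thesis by (simp add: gker'_def gker_def mult_ac)
  qed
  ultimately have "(LINT t|lborel. of_real (psi \<eta> t) * iexp (t * y) * zeta_halfplane (crit t))
     = - (LINT w|lborel. complex_of_real (exp (- y / 2) * (frac (exp w) * gker' \<eta> (y - w))))"
    using fub by simp
  also have "\<dots> = of_real (exp (- y / 2) * - (LINT w|lborel. frac (exp w) * gker' \<eta> (y - w)))"
    unfolding integral_complex_of_real by simp
  finally show ?thesis unfolding integral_frac_gker'[OF assms] by simp
qed

section \<open>The mean square bound\<close>

text \<open>The Gaussian weight in \<open>y\<close> makes every double integral absolutely
  convergent, so the inequality follows from Fubini alone. Integrating out \<open>y\<close> couples
  \<open>g t\<close> with the conjugate of \<open>g s\<close> through a Gaussian kernel in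
  \<open>t - s\<close>, and a Schur test bounds this quadratic form by the total mass
  \<open>2 * pi\<close> of the kernel.\<close>

lemma gaussian_plancherel_le:
  fixes g :: "real \<Rightarrow> complex"
  assumes g: "integrable lborel g" and g2: "integrable lborel (\<lambda>t. (norm (g t))\<^sup>2)"
  defines "H \<equiv> \<lambda>y. LINT t|lborel. g t * iexp (t * y)"
  shows "integrable lborel (\<lambda>y. (norm (H y))\<^sup>2 * exp (- y\<^sup>2 / 2))"
    and "(LINT y|lborel. (norm (H y))\<^sup>2 * exp (- y\<^sup>2 / 2)) \<le> 2 * pi * (LINT t|lborel. (norm (g t))\<^sup>2)"
proof -
  define B where "B = (LINT t|lborel. norm (g t))"
  have g_meas[measurable]: "g \<in> borel_measurable borel" using g by auto
  have cnj_meas[measurable]: "cnj \<in> borel_measurable borel"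
    by (intro borel_measurable_continuous_onI continuous_intros)
  have "(\<lambda>(y, t). g t * iexp (t * y)) \<in> borel_measurable (borel \<Otimes>\<^sub>M lborel)" by measurable
  then have H_meas[measurable]: "H \<in> borel_measurable borel"
    unfolding H_def by (rule lborel.borel_measurable_lebesgue_integral)
  have H_le: "norm (H y) \<le> B" for y
    using integral_norm_bound[of lborel "\<lambda>t. g t * iexp (t * y)"] by (simp add: H_def B_def norm_mult)
  have B0: "0 \<le> B" by (simp add: B_def)
  have gauss: "has_bochner_integral lborel (\<lambda>y. exp (- y\<^sup>2 / 2 :: real)) (sqrt (2 * pi))"
    using has_bochner_integral_gauss[of 1] by simp
  have gauss_iexp: "integrable lborel (\<lambda>y. of_real (exp (- y\<^sup>2 / 2)) * iexp (y * x))" for x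
    using has_bochner_integral_gauss_iexp[of 1 x] by (simp add: has_bochner_integral_iff)
  show int: "integrable lborel (\<lambda>y. (norm (H y))\<^sup>2 * exp (- y\<^sup>2 / 2))"
  proof (rule Bochner_Integration.integrable_bound)
    show "integrable lborel (\<lambda>y. B\<^sup>2 * exp (- y\<^sup>2 / 2))"
      using gauss by (intro integrable_mult_right) (rule integrable.intros)
    show "AE y in lborel. norm ((norm (H y))\<^sup>2 * exp (- y\<^sup>2 / 2)) \<le> norm (B\<^sup>2 * exp (- y\<^sup>2 / 2))"
      using H_le by (intro AE_I2) (auto intro!: power_mono)
  qed measurable
  \<comment> \<open>\<open>W\<close> is the transform of the weighted conjugate of \<open>H\<close>;
    equivalently, the conjugate of \<open>g\<close> convolved with a Gaussian.\<close>
  define W where "W t = (LINT y|lborel. cnj (H y) * iexp (t * y) * of_real (exp (- y\<^sup>2 / 2)))" for t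
  have W: "W t = (LINT s|lborel. cnj (g s) * of_real (sqrt (2 * pi) * exp (- (t - s)\<^sup>2 / 2)))" for t
  proof -
    define f where "f s y = cnj (g s) * (of_real (exp (- y\<^sup>2 / 2)) * iexp (y * (t - s)))" for s y
    have "integrable (lborel \<Otimes>\<^sub>M lborel) (case_prod f)"
    proof (rule lborel_pair.Fubini_integrable)
      show "case_prod f \<in> borel_measurable (lborel \<Otimes>\<^sub>M lborel)" unfolding f_def[abs_def] by measurable
      show "integrable lborel (\<lambda>x. LINT y|lborel. norm (case_prod f (x, y)))"
        using integrable_mult_left[OF integrable_norm[OF g], of "sqrt (2 * pi)"]
        by (simp add: f_def norm_mult has_bochner_integral_integral_eq[OF gauss])
      show "AE x in lborel. integrable lborel (\<lambda>y. case_prod f (x, y))"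
        unfolding prod.case f_def by (intro AE_I2 integrable_mult_right gauss_iexp)
    qed
    from lborel_pair.Fubini_integral[OF this]
    have "(LINT y|lborel. LINT s|lborel. f s y) = (LINT s|lborel. LINT y|lborel. f s y)" .
    moreover have "(LINT s|lborel. f s y) = cnj (H y) * iexp (t * y) * of_real (exp (- y\<^sup>2 / 2))" for y
    proof -
      have "cnj (H y) = (LINT s|lborel. cnj (g s * iexp (s * y)))"
        unfolding H_def by (rule Bochner_Integration.integral_cnj[symmetric])
      moreover have "f s y = cnj (g s * iexp (s * y)) * (iexp (t * y) * of_real (exp (- y\<^sup>2 / 2)))" for s
      proof -
        have "iexp (y * (t - s)) = cnj (iexp (s * y)) * iexp (t * y)"
          by (simp add: exp_cnj algebra_simps flip: exp_add)
        then show ?thesis by (simp add: f_def mult_ac)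
      qed
      ultimately show ?thesis by (simp only: integral_mult_left_zero mult.assoc)
    qed
    moreover have "(LINT y|lborel. f s y) = cnj (g s) * of_real (sqrt (2 * pi) * exp (- (t - s)\<^sup>2 / 2))" for s
      unfolding f_def integral_mult_right_zero
      using has_bochner_integral_gauss_iexp[of 1 "t - s"] by (simp add: has_bochner_integral_iff)
    ultimately show ?thesis by (simp add: W_def)
  qed
  have eq: "of_real (LINT y|lborel. (norm (H y))\<^sup>2 * exp (- y\<^sup>2 / 2)) = (LINT t|lborel. g t * W t)"
    and intW: "integrable lborel (\<lambda>t. g t * W t)"
  proof -
    define f where "f t y = g t * (cnj (H y) * iexp (t * y) * of_real (exp (- y\<^sup>2 / 2)))" for t y
    have int1: "integrable lborel (\<lambda>y. cnj (H y) * iexp (t * y) * of_real (exp (- y\<^sup>2 / 2)))" for t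
    proof (rule Bochner_Integration.integrable_bound)
      show "integrable lborel (\<lambda>y. B * exp (- y\<^sup>2 / 2))"
        using gauss by (intro integrable_mult_right) (rule integrable.intros)
      show "AE y in lborel. norm (cnj (H y) * iexp (t * y) * of_real (exp (- y\<^sup>2 / 2))) \<le> norm (B * exp (- y\<^sup>2 / 2))"
        using H_le B0 by (intro AE_I2) (simp add: norm_mult)
    qed measurable
    have int: "integrable (lborel \<Otimes>\<^sub>M lborel) (case_prod f)"
    proof (rule lborel_pair.Fubini_integrable)
      show "case_prod f \<in> borel_measurable (lborel \<Otimes>\<^sub>M lborel)" unfolding f_def[abs_def] by measurable
      show "integrable lborel (\<lambda>x. LINT y|lborel. norm (case_prod f (x, y)))"
        using integrable_mult_left[OF integrable_norm[OF g]] by (simp add: f_def norm_mult)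
      show "AE x in lborel. integrable lborel (\<lambda>y. case_prod f (x, y))"
        unfolding prod.case f_def using int1 by (intro AE_I2 integrable_mult_right)
    qed
    have ft: "(LINT y|lborel. f t y) = g t * W t" for t by (simp add: f_def W_def)
    from lborel_pair.integrable_fst[OF int] show "integrable lborel (\<lambda>t. g t * W t)" by (simp add: ft)
    have "(LINT t|lborel. f t y) = of_real ((norm (H y))\<^sup>2 * exp (- y\<^sup>2 / 2))" for y
    proof -
      have "f t y = (g t * iexp (t * y)) * (cnj (H y) * of_real (exp (- y\<^sup>2 / 2)))" for t
        by (simp add: f_def mult_ac)
      then have "(LINT t|lborel. f t y) = H y * (cnj (H y) * of_real (exp (- y\<^sup>2 / 2)))"
        unfolding H_def by (simp only: integral_mult_left_zero)
      then show ?thesis by (simp only: complex_norm_square of_real_mult mult.assoc)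
    qed
    then show "of_real (LINT y|lborel. (norm (H y))\<^sup>2 * exp (- y\<^sup>2 / 2)) = (LINT t|lborel. g t * W t)"
      using lborel_pair.Fubini_integral[OF int] by (simp add: ft flip: integral_complex_of_real)
  qed
  \<comment> \<open>The Schur test rests on \<open>2 |g t| |g s| \<le> |g t|^2 + |g s|^2\<close>.
    The \<open>|g t|^2\<close> half integrates trivially in \<open>s\<close>; \<open>G\<close> is
    the other half, which becomes equally large after integrating in \<open>t\<close>.\<close>
  define G where "G s t = (norm (g s))\<^sup>2 * exp (- (t - s)\<^sup>2 / 2)" for s t
  have gauss': "has_bochner_integral lborel (\<lambda>s. exp (- (t - s)\<^sup>2 / 2)) (sqrt (2 * pi))" for t :: real
    using lborel_has_bochner_integral_real_affine_iff[THEN iffD1, OF _ gauss, of "-1" t] by simp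
  have gauss'': "has_bochner_integral lborel (\<lambda>s. exp (- (s - t)\<^sup>2 / 2)) (sqrt (2 * pi))" for t :: real
    using gauss'[of t] by (simp add: power2_commute)
  have gauss_val: "(LINT s|lborel. exp (- ((t - s)\<^sup>2 / 2))) = sqrt (2 * pi)"
    "(LINT s|lborel. exp (- ((s - t)\<^sup>2 / 2))) = sqrt (2 * pi)" for t :: real
    using has_bochner_integral_integral_eq[OF gauss'[of t]] has_bochner_integral_integral_eq[OF gauss''[of t]] by simp_all
  have intG: "integrable (lborel \<Otimes>\<^sub>M lborel) (case_prod G)"
  proof (rule lborel_pair.Fubini_integrable)
    show "case_prod G \<in> borel_measurable (lborel \<Otimes>\<^sub>M lborel)" unfolding G_def[abs_def] by measurable
    show "integrable lborel (\<lambda>x. LINT y|lborel. norm (case_prod G (x, y)))"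
      using g2 by (simp add: G_def gauss_val)
    show "AE x in lborel. integrable lborel (\<lambda>y. case_prod G (x, y))"
      unfolding prod.case G_def using gauss''
      by (intro AE_I2 integrable_mult_right) (auto simp: has_bochner_integral_iff)
  qed
  have GI: "integrable lborel (\<lambda>t. LINT s|lborel. G s t)" "AE t in lborel. integrable lborel (\<lambda>s. G s t)"
    "(LINT t|lborel. LINT s|lborel. G s t) = sqrt (2 * pi) * (LINT t|lborel. (norm (g t))\<^sup>2)"
    using lborel_pair.integrable_snd[OF intG] lborel_pair.AE_integrable_snd[OF intG]
      lborel_pair.Fubini_integral[OF intG]
    by (simp_all add: G_def gauss_val)
  have pt: "AE t in lborel. norm (g t * W t) \<le> sqrt (2 * pi) / 2 * (sqrt (2 * pi) * (norm (g t))\<^sup>2 + (LINT s|lborel. G s t))"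
    using GI(2)
  proof eventually_elim
    case (elim t)
    have i1: "integrable lborel (\<lambda>s. (norm (g t))\<^sup>2 * exp (- (t - s)\<^sup>2 / 2))"
      using gauss'[of t] by (intro integrable_mult_right) (rule integrable.intros)
    have "norm (g t * W t) \<le> norm (g t) * (LINT s|lborel. norm (g s) * (sqrt (2 * pi) * exp (- (t - s)\<^sup>2 / 2)))"
      unfolding norm_mult W
      using integral_norm_bound[of lborel "\<lambda>s. cnj (g s) * of_real (sqrt (2 * pi) * exp (- (t - s)\<^sup>2 / 2))"]
      by (intro mult_left_mono) (simp_all add: norm_mult)
    also have "\<dots> = (LINT s|lborel. norm (g t) * (norm (g s) * (sqrt (2 * pi) * exp (- (t - s)\<^sup>2 / 2))))" by simp
    also have "\<dots> \<le> (LINT s|lborel. sqrt (2 * pi) / 2 * ((norm (g t))\<^sup>2 * exp (- (t - s)\<^sup>2 / 2) + G s t))"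
    proof (rule integral_mono)
      show "integrable lborel (\<lambda>s. sqrt (2 * pi) / 2 * ((norm (g t))\<^sup>2 * exp (- (t - s)\<^sup>2 / 2) + G s t))"
        by (rule integrable_mult_right, rule Bochner_Integration.integrable_add[OF i1 elim])
      show "integrable lborel (\<lambda>s. norm (g t) * (norm (g s) * (sqrt (2 * pi) * exp (- (t - s)\<^sup>2 / 2))))"
      proof (rule Bochner_Integration.integrable_bound)
        show "integrable lborel (\<lambda>s. norm (g t) * (norm (g s) * sqrt (2 * pi)))"
          using g by (intro integrable_mult_right integrable_mult_left integrable_norm)
        show "AE s in lborel. norm (norm (g t) * (norm (g s) * (sqrt (2 * pi) * exp (- (t - s)\<^sup>2 / 2))))
           \<le> norm (norm (g t) * (norm (g s) * sqrt (2 * pi)))"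
          by (intro AE_I2) (simp add: abs_mult mult_left_le mult_left_mono)
      qed measurable
      show "norm (g t) * (norm (g s) * (sqrt (2 * pi) * exp (- (t - s)\<^sup>2 / 2)))
         \<le> sqrt (2 * pi) / 2 * ((norm (g t))\<^sup>2 * exp (- (t - s)\<^sup>2 / 2) + G s t)" for s
      proof -
        have "2 * norm (g t) * norm (g s) \<le> (norm (g t))\<^sup>2 + (norm (g s))\<^sup>2"
          by (rule sum_squares_bound)
        then have "(2 * norm (g t) * norm (g s)) * (sqrt (2 * pi) / 2 * exp (- (t - s)\<^sup>2 / 2))
          \<le> ((norm (g t))\<^sup>2 + (norm (g s))\<^sup>2) * (sqrt (2 * pi) / 2 * exp (- (t - s)\<^sup>2 / 2))"
          by (rule mult_right_mono) simp
        then show ?thesis unfolding G_def by (simp add: algebra_simps)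
      qed
    qed
    also have "\<dots> = sqrt (2 * pi) / 2 * (sqrt (2 * pi) * (norm (g t))\<^sup>2 + (LINT s|lborel. G s t))"
      using i1 elim by (simp add: gauss_val mult_ac)
    finally show ?case .
  qed
  have "(LINT y|lborel. (norm (H y))\<^sup>2 * exp (- y\<^sup>2 / 2)) \<le> norm (LINT t|lborel. g t * W t)"
    unfolding eq[symmetric] by simp
  also have "\<dots> \<le> (LINT t|lborel. norm (g t * W t))" by (rule integral_norm_bound)
  also have "\<dots> \<le> (LINT t|lborel. sqrt (2 * pi) / 2 * (sqrt (2 * pi) * (norm (g t))\<^sup>2 + (LINT s|lborel. G s t)))"
    using GI(1) g2 intW by (intro integral_mono_AE pt integrable_norm integrable_mult_right Bochner_Integration.integrable_add)
  also have "\<dots> = sqrt (2 * pi) / 2 * (sqrt (2 * pi) * (LINT t|lborel. (norm (g t))\<^sup>2) + sqrt (2 * pi) * (LINT t|lborel. (norm (g t))\<^sup>2))"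
    using GI(1) g2 by (simp add: GI(3))
  also have "\<dots> = (sqrt (2 * pi))\<^sup>2 * (LINT t|lborel. (norm (g t))\<^sup>2)"
    by (simp add: power2_eq_square algebra_simps)
  finally show "(LINT y|lborel. (norm (H y))\<^sup>2 * exp (- y\<^sup>2 / 2)) \<le> 2 * pi * (LINT t|lborel. (norm (g t))\<^sup>2)"
    by simp
qed

text \<open>
  With \<open>u = exp y\<close>, the smoothed number of integers near \<open>u\<close> minus its mean; the factor
  \<open>u\<^bsup>-1/2\<^esup>\<close> puts its Fourier transform on the critical line.
\<close>
definition hsum :: "real \<Rightarrow> real \<Rightarrow> real" where
  "hsum \<eta> y = exp (- y / 2) * ((\<Sum>j. gker \<eta> (y - ln (Suc j))) - exp y * (\<eta> * sqrt (2 * pi) * exp (\<eta>\<^sup>2 / 8)))"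

lemma norm_sum_iexp_sq:
  assumes "finite I"
  shows "of_real ((norm (\<Sum>i\<in>I. iexp (t * l i)))\<^sup>2) = (\<Sum>i\<in>I. \<Sum>j\<in>I. iexp (t * (l i - l j)))"
proof -
  have "iexp (t * (l i - l j)) = iexp (t * l i) * cnj (iexp (t * l j))" for i j
    by (simp add: exp_cnj algebra_simps flip: exp_add)
  then show ?thesis
    by (simp only: complex_norm_square cnj_sum sum_product)
qed

text \<open>Expanding the square leaves one Gaussian transform for each pair of frequencies. All
  terms on the right are positive and at most 1 up to the common factor, so the mean square
  essentially counts pairs of frequencies within distance \<open>\<eta>\<close>.\<close>

lemma has_bochner_integral_gauss_sum_iexp:
  assumes "\<eta> > 0" "finite I"
  shows "has_bochner_integral lborel (\<lambda>t. exp (- (\<eta> * t)\<^sup>2 / 2) * (norm (\<Sum>i\<in>I. iexp (t * l i)))\<^sup>2)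
     (sqrt (2 * pi) / \<eta> * (\<Sum>i\<in>I. \<Sum>j\<in>I. exp (- (l i - l j)\<^sup>2 / (2 * \<eta>\<^sup>2))))"
proof -
  have "has_bochner_integral lborel (\<lambda>t. \<Sum>i\<in>I. \<Sum>j\<in>I. complex_of_real (exp (- (\<eta> * t)\<^sup>2 / 2)) * iexp (t * (l i - l j)))
     (\<Sum>i\<in>I. \<Sum>j\<in>I. of_real (sqrt (2 * pi) / \<eta> * exp (- (l i - l j)\<^sup>2 / (2 * \<eta>\<^sup>2))))"
    by (intro has_bochner_integral_sum has_bochner_integral_gauss_iexp assms)
  also have "(\<lambda>t. \<Sum>i\<in>I. \<Sum>j\<in>I. complex_of_real (exp (- (\<eta> * t)\<^sup>2 / 2)) * iexp (t * (l i - l j)))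
     = (\<lambda>t. of_real (exp (- (\<eta> * t)\<^sup>2 / 2) * (norm (\<Sum>i\<in>I. iexp (t * l i)))\<^sup>2))"
    unfolding of_real_mult[where x = "exp u" for u] norm_sum_iexp_sq[OF assms(2)] by (simp only: sum_distrib_left)
  also have "(\<Sum>i\<in>I. \<Sum>j\<in>I. of_real (sqrt (2 * pi) / \<eta> * exp (- (l i - l j)\<^sup>2 / (2 * \<eta>\<^sup>2))))
     = complex_of_real (sqrt (2 * pi) / \<eta> * (\<Sum>i\<in>I. \<Sum>j\<in>I. exp (- (l i - l j)\<^sup>2 / (2 * \<eta>\<^sup>2))))"
    by (simp only: sum_distrib_left of_real_sum)
  finally show ?thesis
    using has_bochner_integral_bounded_linear[OF bounded_linear_Re] by (fastforce simp only: Re_complex_of_real)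
qed

text \<open>This lets half of the Gaussian in \<open>(psi \<eta> t)\<^sup>2\<close> pay for the
  growth of zeta. Beyond \<open>|t| = 1 / \<eta>\<close> the power is beaten by the Gaussian, and up
  to there it costs only \<open>\<eta> powr (- 2 * \<epsilon>)\<close>; the comparison is
  \<open>1 + |t| \<le> (1 + \<eta> |t|) / \<eta>\<close>, which uses
  \<open>\<eta> \<le> 1\<close>.\<close>

lemma powr_le_gauss:
  fixes \<eta> \<epsilon> t :: real
  assumes \<eta>: "\<eta> > 0" "\<eta> \<le> 1" and \<epsilon>: "\<epsilon> > 0" "\<epsilon> \<le> 1"
  shows "((1 + \<bar>t\<bar>) powr \<epsilon>)\<^sup>2 \<le> 4 * \<eta> powr (- 2 * \<epsilon>) * exp ((\<eta> * t)\<^sup>2 / 2)"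
proof -
  define a where "a = \<eta> * \<bar>t\<bar>"
  have a: "0 \<le> a" unfolding a_def by (rule mult_nonneg_nonneg) (use \<eta> in auto)
  have "(1 + a) powr (2 * \<epsilon>) \<le> (1 + a) powr 2"
    using a \<epsilon> by (intro powr_mono) auto
  also have "(1 + a) powr 2 = (1 + a)\<^sup>2" using a by simp
  also have "(1 + a)\<^sup>2 \<le> 4 * (1 + a\<^sup>2 / 2)"
    using zero_le_power2[of "1 - a"] by (simp add: power2_sum power2_diff)
  also have "4 * (1 + a\<^sup>2 / 2) \<le> 4 * exp (a\<^sup>2 / 2)"
    using exp_ge_add_one_self[of "a\<^sup>2 / 2"] by (rule mult_left_mono) simp
  also have "a\<^sup>2 = (\<eta> * t)\<^sup>2" by (simp add: a_def power_mult_distrib)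
  finally have le: "(1 + a) powr (2 * \<epsilon>) \<le> 4 * exp ((\<eta> * t)\<^sup>2 / 2)" .
  have "((1 + \<bar>t\<bar>) powr \<epsilon>)\<^sup>2 = (1 + \<bar>t\<bar>) powr (2 * \<epsilon>)"
    by (simp add: power2_eq_square flip: powr_add)
  also have "\<dots> \<le> ((1 + a) / \<eta>) powr (2 * \<epsilon>)"
    using \<eta> \<epsilon> by (intro powr_mono2) (auto simp: a_def field_simps)
  also have "\<dots> = \<eta> powr (- 2 * \<epsilon>) * (1 + a) powr (2 * \<epsilon>)"
    using a \<eta> by (simp add: powr_divide powr_minus_divide)
  also have "\<dots> \<le> \<eta> powr (- 2 * \<epsilon>) * (4 * exp ((\<eta> * t)\<^sup>2 / 2))"
    using le by (rule mult_left_mono) simp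
  finally show ?thesis by (simp only: mult_ac)
qed

lemma hsum_L2_bound:
  fixes l :: "'i \<Rightarrow> real"
  assumes \<eta>: "\<eta> > 0" "\<eta> \<le> 1" and \<epsilon>: "\<epsilon> > 0" "\<epsilon> \<le> 1" and I: "finite I"
    and zeta: "\<And>t. norm (zeta_halfplane (crit t)) \<le> K * (1 + \<bar>t\<bar>) powr \<epsilon>"
  defines "H \<equiv> \<lambda>y. \<Sum>i\<in>I. hsum \<eta> (y + l i)"
  shows "integrable lborel (\<lambda>y. (H y)\<^sup>2 * exp (- y\<^sup>2 / 2))"
    and "(LINT y|lborel. (H y)\<^sup>2 * exp (- y\<^sup>2 / 2))
       \<le> 4 * sqrt (2 * pi) * K\<^sup>2 * \<eta> powr (1 - 2 * \<epsilon>) * (\<Sum>i\<in>I. \<Sum>j\<in>I. exp (- (l i - l j)\<^sup>2 / (2 * \<eta>\<^sup>2)))"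
proof -
  define P where "P t = (\<Sum>i\<in>I. iexp (t * l i))" for t
  define a where "a t = of_real (psi \<eta> t) * zeta_halfplane (crit t)" for t
  define g where "g t = a t * P t" for t
  have a_meas[measurable]: "a \<in> borel_measurable borel" unfolding a_def[abs_def] by measurable
  have P_meas[measurable]: "P \<in> borel_measurable borel" unfolding P_def[abs_def] by measurable
  have K0: "0 \<le> K" using order.trans[OF norm_ge_zero zeta[of 0]] by simp
  have norm_P: "norm (P t) \<le> card I" for t
    unfolding P_def by (rule order.trans[OF norm_sum]) simp
  have a_int: "integrable lborel a"
  proof (rule Bochner_Integration.integrable_bound)
    show "integrable lborel (\<lambda>t. K * (\<eta> / sqrt (2 * pi)) * (exp (- (\<eta> * t)\<^sup>2 / 2) * \<bar>t\<bar> ^ 0 + exp (- (\<eta> * t)\<^sup>2 / 2) * \<bar>t\<bar> ^ 1))"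
      by (intro integrable_mult_right Bochner_Integration.integrable_add integrable_gauss_moment \<eta>)
    have "norm (a t) \<le> norm (K * (\<eta> / sqrt (2 * pi)) * (exp (- (\<eta> * t)\<^sup>2 / 2) * \<bar>t\<bar> ^ 0 + exp (- (\<eta> * t)\<^sup>2 / 2) * \<bar>t\<bar> ^ 1))" for t
    proof -
      have "(1 + \<bar>t\<bar>) powr \<epsilon> \<le> (1 + \<bar>t\<bar>) powr 1" using \<epsilon> by (intro powr_mono) auto
      then have "norm (zeta_halfplane (crit t)) \<le> K * (1 + \<bar>t\<bar>)"
        using zeta[of t] K0 mult_left_mono[of "(1 + \<bar>t\<bar>) powr \<epsilon>" "1 + \<bar>t\<bar>" K] by simp
      then have "norm (a t) \<le> psi \<eta> t * (K * (1 + \<bar>t\<bar>))"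
        using psi_nonneg[OF \<eta>(1), of t] by (simp add: a_def norm_mult mult_left_mono)
      also have "\<dots> = K * (\<eta> / sqrt (2 * pi)) * (exp (- (\<eta> * t)\<^sup>2 / 2) * \<bar>t\<bar> ^ 0 + exp (- (\<eta> * t)\<^sup>2 / 2) * \<bar>t\<bar> ^ 1)"
        by (simp add: psi_def algebra_simps add_divide_distrib)
      finally show ?thesis unfolding real_norm_def by (rule order.trans[OF _ abs_ge_self])
    qed
    then show "AE t in lborel. norm (a t) \<le> norm (K * (\<eta> / sqrt (2 * pi)) * (exp (- (\<eta> * t)\<^sup>2 / 2) * \<bar>t\<bar> ^ 0 + exp (- (\<eta> * t)\<^sup>2 / 2) * \<bar>t\<bar> ^ 1))"
      by (rule AE_I2)
  qed measurable
  have g_int: "integrable lborel g"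
  proof (rule Bochner_Integration.integrable_bound[OF integrable_mult_left[OF integrable_norm[OF a_int], of "card I"]])
    show "AE t in lborel. norm (g t) \<le> norm (norm (a t) * real (card I))"
      using norm_P by (intro AE_I2) (simp add: g_def norm_mult mult_left_mono)
  qed (unfold g_def[abs_def], measurable)
  \<comment> \<open>Product of the factor \<open>\<eta>\<^sup>2 / (2 * pi)\<close> of
    \<open>(psi \<eta> t)\<^sup>2\<close> and the factor
    \<open>4 * K\<^sup>2 * \<eta> powr (- 2 * \<epsilon>)\<close> coming from
    \<open>powr_le_gauss\<close>.\<close>
  define C where "C = 2 * K\<^sup>2 * \<eta>\<^sup>2 * \<eta> powr (- 2 * \<epsilon>) / pi"
  note G = has_bochner_integral_gauss_sum_iexp[OF \<eta>(1) I, of l, folded P_def]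
  have g2_le: "(norm (g t))\<^sup>2 \<le> C * (exp (- (\<eta> * t)\<^sup>2 / 2) * (norm (P t))\<^sup>2)" for t
  proof -
    have "(norm (zeta_halfplane (crit t)))\<^sup>2 \<le> (K * (1 + \<bar>t\<bar>) powr \<epsilon>)\<^sup>2"
      by (intro power_mono zeta) simp
    also have "\<dots> = K\<^sup>2 * ((1 + \<bar>t\<bar>) powr \<epsilon>)\<^sup>2" by (rule power_mult_distrib)
    also have "\<dots> \<le> K\<^sup>2 * (4 * \<eta> powr (- 2 * \<epsilon>) * exp ((\<eta> * t)\<^sup>2 / 2))"
      by (intro mult_left_mono powr_le_gauss \<eta> \<epsilon>) simp
    finally have "(psi \<eta> t)\<^sup>2 * (norm (zeta_halfplane (crit t)))\<^sup>2
      \<le> (psi \<eta> t)\<^sup>2 * (K\<^sup>2 * (4 * \<eta> powr (- 2 * \<epsilon>) * exp ((\<eta> * t)\<^sup>2 / 2)))"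
      by (rule mult_left_mono) simp
    moreover have "(psi \<eta> t)\<^sup>2 = \<eta>\<^sup>2 / (2 * pi) * exp (- (\<eta> * t)\<^sup>2)"
      by (simp add: psi_def power_mult_distrib power_divide flip: exp_double)
    moreover have "exp (- (\<eta> * t)\<^sup>2) * exp ((\<eta> * t)\<^sup>2 / 2) = exp (- (\<eta> * t)\<^sup>2 / 2)"
      by (simp flip: exp_add)
    ultimately have "(psi \<eta> t)\<^sup>2 * (norm (zeta_halfplane (crit t)))\<^sup>2 \<le> C * exp (- (\<eta> * t)\<^sup>2 / 2)"
      by (simp add: C_def mult_ac)
    from mult_right_mono[OF this, of "(norm (P t))\<^sup>2"] show ?thesis
      using psi_nonneg[OF \<eta>(1), of t] by (simp add: g_def a_def norm_mult power_mult_distrib mult_ac)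
  qed
  have C0: "0 \<le> C" by (simp add: C_def)
  have CG: "integrable lborel (\<lambda>t. C * (exp (- (\<eta> * t)\<^sup>2 / 2) * (norm (P t))\<^sup>2))"
    using G by (intro integrable_mult_right) (rule integrable.intros)
  have g2_int: "integrable lborel (\<lambda>t. (norm (g t))\<^sup>2)"
  proof (rule Bochner_Integration.integrable_bound[OF CG])
    show "AE t in lborel. norm ((norm (g t))\<^sup>2) \<le> norm (C * (exp (- (\<eta> * t)\<^sup>2 / 2) * (norm (P t))\<^sup>2))"
      using g2_le C0 by (intro AE_I2) simp
  qed (unfold g_def[abs_def], measurable)
  \<comment> \<open>Translating \<open>hsum\<close> by \<open>l i\<close> multiplies its transform
    by \<open>iexp (t * l i)\<close>, so the whole sum has transform \<open>psi\<close> times zeta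
    times the single exponential sum \<open>P\<close>.\<close>
  have H: "(LINT t|lborel. g t * iexp (t * y)) = of_real (H y)" for y
  proof -
    have "g t * iexp (t * y) = (\<Sum>i\<in>I. of_real (psi \<eta> t) * iexp (t * (y + l i)) * zeta_halfplane (crit t))" for t
    proof -
      have "iexp (t * (y + l i)) = iexp (t * l i) * iexp (t * y)" for i
        by (simp add: algebra_simps flip: exp_add)
      then show ?thesis
        by (simp only: g_def a_def P_def sum_distrib_left sum_distrib_right mult_ac)
    qed
    moreover have "integrable lborel (\<lambda>t. of_real (psi \<eta> t) * iexp (t * (y + l i)) * zeta_halfplane (crit t))" for i
    proof (rule Bochner_Integration.integrable_bound[OF a_int])
      show "AE t in lborel. norm (of_real (psi \<eta> t) * iexp (t * (y + l i)) * zeta_halfplane (crit t)) \<le> norm (a t)"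
        by (intro AE_I2) (simp add: a_def norm_mult)
    qed measurable
    ultimately have "(LINT t|lborel. g t * iexp (t * y))
       = (\<Sum>i\<in>I. LINT t|lborel. of_real (psi \<eta> t) * iexp (t * (y + l i)) * zeta_halfplane (crit t))"
      by (simp only: Bochner_Integration.integral_sum)
    also have "\<dots> = of_real (H y)"
      unfolding H_def hsum_def by (simp only: muntz_formula[OF \<eta>(1)] of_real_sum)
    finally show ?thesis .
  qed
  note pl = gaussian_plancherel_le[OF g_int g2_int, unfolded H norm_of_real power2_abs]
  show "integrable lborel (\<lambda>y. (H y)\<^sup>2 * exp (- y\<^sup>2 / 2))" by (rule pl(1))
  have "(LINT y|lborel. (H y)\<^sup>2 * exp (- y\<^sup>2 / 2)) \<le> 2 * pi * (LINT t|lborel. (norm (g t))\<^sup>2)" by (rule pl(2))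
  also have "\<dots> \<le> 2 * pi * (LINT t|lborel. C * (exp (- (\<eta> * t)\<^sup>2 / 2) * (norm (P t))\<^sup>2))"
    by (intro mult_left_mono integral_mono g2_int CG g2_le) simp
  also have "(LINT t|lborel. C * (exp (- (\<eta> * t)\<^sup>2 / 2) * (norm (P t))\<^sup>2))
     = C * (sqrt (2 * pi) / \<eta> * (\<Sum>i\<in>I. \<Sum>j\<in>I. exp (- (l i - l j)\<^sup>2 / (2 * \<eta>\<^sup>2))))"
    by (simp only: integral_mult_right_zero has_bochner_integral_integral_eq[OF G])
  also have "2 * pi * \<dots> = 4 * sqrt (2 * pi) * K\<^sup>2 * (\<eta> * \<eta> powr (- 2 * \<epsilon>)) * (\<Sum>i\<in>I. \<Sum>j\<in>I. exp (- (l i - l j)\<^sup>2 / (2 * \<eta>\<^sup>2)))"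
    using \<eta> by (simp add: C_def power2_eq_square)
  also have "\<eta> * \<eta> powr (- 2 * \<epsilon>) = \<eta> powr (1 - 2 * \<epsilon>)"
    using \<eta> by (simp add: powr_diff powr_minus divide_inverse)
  finally show "(LINT y|lborel. (H y)\<^sup>2 * exp (- y\<^sup>2 / 2))
       \<le> 4 * sqrt (2 * pi) * K\<^sup>2 * \<eta> powr (1 - 2 * \<epsilon>) * (\<Sum>i\<in>I. \<Sum>j\<in>I. exp (- (l i - l j)\<^sup>2 / (2 * \<eta>\<^sup>2)))" .
qed

section \<open>Parameters without near-coincidences\<close>

lemma ln_diff_ge:
  fixes a b :: real
  assumes "0 < a" "a \<le> b" shows "(b - a) / b \<le> ln b - ln a"
proof -
  have "ln (a / b) \<le> a / b - 1" using assms by (intro ln_le_minus_one) auto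
  then show ?thesis using assms by (simp add: ln_div diff_divide_distrib)
qed

lemma abs_ln_diff_ge:
  fixes a b :: real
  assumes "0 < a" "0 < b" "a \<le> M" "b \<le> M"
  shows "\<bar>a - b\<bar> / M \<le> \<bar>ln a - ln b\<bar>"
proof (cases "a \<le> b")
  case True
  have "(b - a) / M \<le> (b - a) / b" using True assms by (intro divide_left_mono) auto
  with ln_diff_ge[OF assms(1) True] True assms show ?thesis by simp
next
  case False
  then have "(a - b) / M \<le> (a - b) / a" using assms by (intro divide_left_mono) auto
  with ln_diff_ge[OF assms(2), of a] False assms show ?thesis by simp
qed

text \<open>The Gaussian exponent is split in halves. One half supplies the smallness, since every
  \<open>ln (u / n)\<close> is at least \<open>\<delta> / (2 u)\<close> in absolute value. The other
  half trades \<open>exp (x / 2)\<close> for \<open>exp (2 * x) = u\<^sup>2 / n\<^sup>2\<close>,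
  which makes the sum over \<open>n\<close> converge and explains the factor
  \<open>pi\<^sup>2 / 6\<close>.\<close>

lemma gker_sum_no_hit:
  assumes \<eta>: "\<eta> > 0" "\<eta> \<le> 1" and \<delta>: "0 < \<delta>" "\<delta> \<le> u"
    and miss: "\<And>j::nat. \<delta> \<le> \<bar>u - real (Suc j)\<bar>"
  shows "(\<Sum>j. gker \<eta> (ln u - ln (Suc j))) \<le> exp (9 / 4) * pi\<^sup>2 / 6 * u\<^sup>2 * exp (- \<delta>\<^sup>2 / (16 * u\<^sup>2 * \<eta>\<^sup>2))"
proof -
  define c where "c = exp (9 / 4) * u\<^sup>2 * exp (- \<delta>\<^sup>2 / (16 * u\<^sup>2 * \<eta>\<^sup>2))"
  have u: "u > 0" using \<delta> by simp
  have le: "gker \<eta> (ln u - ln (Suc j)) \<le> c * (1 / (real j + 1)\<^sup>2)" for j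
  proof -
    define n where "n = real (Suc j)"
    define x where "x = ln u - ln n"
    have n: "n > 0" by (simp add: n_def)
    \<comment> \<open>For \<open>n \<le> 2 * u\<close> the logarithm has slope at least
      \<open>1 / (2 * u)\<close> between the two points; for larger \<open>n\<close> the distance
      already exceeds 1/2, and \<open>\<delta> \<le> u\<close> suffices.\<close>
    have "\<delta> / (2 * u) \<le> \<bar>x\<bar>"
    proof (cases "n \<le> 2 * u")
      case True
      have "\<delta> / (2 * u) \<le> \<bar>u - n\<bar> / (2 * u)"
        using miss[of j] u by (intro divide_right_mono) (auto simp: n_def)
      also have "\<dots> \<le> \<bar>x\<bar>" unfolding x_def using u n True by (intro abs_ln_diff_ge) auto
      finally show ?thesis .
    next
      case False
      have "\<delta> / (2 * u) \<le> 1 / 2" using \<delta> u by (simp add: field_simps)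
      also have "\<dots> \<le> (n - u) / n" using False n by (simp add: field_simps)
      also have "\<dots> \<le> ln n - ln u" using False u by (intro ln_diff_ge) auto
      finally show ?thesis by (simp add: x_def)
    qed
    then have "(\<delta> / (2 * u))\<^sup>2 \<le> \<bar>x\<bar>\<^sup>2" using \<delta> u by (intro power_mono) auto
    then have "\<delta>\<^sup>2 / (4 * u\<^sup>2) \<le> x\<^sup>2" by (simp add: power_divide power_mult_distrib)
    then have "\<delta>\<^sup>2 / (4 * u\<^sup>2) / (4 * \<eta>\<^sup>2) \<le> x\<^sup>2 / (4 * \<eta>\<^sup>2)" by (rule divide_right_mono) simp
    then have 1: "- x\<^sup>2 / (4 * \<eta>\<^sup>2) \<le> - \<delta>\<^sup>2 / (16 * u\<^sup>2 * \<eta>\<^sup>2)" by (simp add: mult_ac)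
    \<comment> \<open>This square is chosen so that its mixed term is \<open>3 * x / 2\<close>, the
      difference between the exponents \<open>2 * x\<close> and \<open>x / 2\<close>; its last term
      is the origin of the constant 9/4.\<close>
    have "0 \<le> (x / (2 * \<eta>) + 3 * \<eta> / 2)\<^sup>2" by simp
    also have "\<dots> = x\<^sup>2 / (4 * \<eta>\<^sup>2) + 3 * x / 2 + 9 * \<eta>\<^sup>2 / 4"
      using \<eta> by (simp add: power2_sum power_divide power_mult_distrib)
    finally have "x / 2 + - x\<^sup>2 / (4 * \<eta>\<^sup>2) \<le> 2 * x + 9 * \<eta>\<^sup>2 / 4" by simp
    moreover have "\<eta>\<^sup>2 \<le> 1" using \<eta> by (simp add: power_le_one)
    ultimately have "x / 2 + - x\<^sup>2 / (4 * \<eta>\<^sup>2) \<le> 2 * x + 9 / 4" by simp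
    moreover have "- x\<^sup>2 / (2 * \<eta>\<^sup>2) = - x\<^sup>2 / (4 * \<eta>\<^sup>2) + - x\<^sup>2 / (4 * \<eta>\<^sup>2)" by simp
    ultimately have "x / 2 + - x\<^sup>2 / (2 * \<eta>\<^sup>2) \<le> 9 / 4 + 2 * x + - \<delta>\<^sup>2 / (16 * u\<^sup>2 * \<eta>\<^sup>2)"
      using 1 by linarith
    then have "gker \<eta> x \<le> exp (9 / 4) * exp (2 * x) * exp (- \<delta>\<^sup>2 / (16 * u\<^sup>2 * \<eta>\<^sup>2))"
      unfolding gker_def by (simp only: flip: exp_add) simp
    moreover have "exp (2 * x) = u\<^sup>2 / n\<^sup>2"
      using u n by (simp add: x_def exp_double exp_diff power_divide)
    ultimately show ?thesis by (simp add: c_def x_def n_def mult_ac add_ac)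
  qed
  have sq: "(\<lambda>j. c * (1 / (real j + 1)\<^sup>2)) sums (c * (pi\<^sup>2 / 6))"
    using inverse_squares_sums by (intro sums_mult) (simp add: add_ac)
  have "(\<Sum>j. gker \<eta> (ln u - ln (Suc j))) \<le> (\<Sum>j. c * (1 / (real j + 1)\<^sup>2))"
    by (intro suminf_le le sums_summable[OF integral_floor_gker'[OF \<eta>(1)]] sums_summable[OF sq])
  also have "\<dots> = c * (pi\<^sup>2 / 6)" using sq by (rule sums_unique[symmetric])
  finally show ?thesis by (simp add: c_def mult_ac)
qed

lemma hsum_measurable[measurable]: "hsum \<eta> \<in> borel_measurable borel"
  unfolding hsum_def[abs_def] by measurable

lemma hsum_no_hit:
  assumes \<eta>: "\<eta> > 0" "\<eta> \<le> 1" and \<delta>: "0 < \<delta>" "\<delta> \<le> exp v"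
    and miss: "\<And>j::nat. \<delta> \<le> \<bar>exp v - real (Suc j)\<bar>"
    and U: "exp v \<le> U" and small: "exp (9 / 4) * pi\<^sup>2 / 6 * U * exp (- \<delta>\<^sup>2 / (16 * U\<^sup>2 * \<eta>\<^sup>2)) \<le> \<eta>"
  shows "hsum \<eta> v \<le> - \<eta> * exp (v / 2)"
proof -
  define u where "u = exp v"
  have u: "u > 0" "u \<le> U" and v: "v = ln u" using U by (simp_all add: u_def)
  have "\<delta>\<^sup>2 / (16 * U\<^sup>2 * \<eta>\<^sup>2) \<le> \<delta>\<^sup>2 / (16 * u\<^sup>2 * \<eta>\<^sup>2)"
    using u \<eta> by (intro divide_left_mono mult_right_mono mult_left_mono power_mono mult_pos_pos) auto
  then have "exp (- \<delta>\<^sup>2 / (16 * u\<^sup>2 * \<eta>\<^sup>2)) \<le> exp (- \<delta>\<^sup>2 / (16 * U\<^sup>2 * \<eta>\<^sup>2))" by simp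
  then have "exp (9 / 4) * pi\<^sup>2 / 6 * u * exp (- \<delta>\<^sup>2 / (16 * u\<^sup>2 * \<eta>\<^sup>2))
     \<le> exp (9 / 4) * pi\<^sup>2 / 6 * U * exp (- \<delta>\<^sup>2 / (16 * U\<^sup>2 * \<eta>\<^sup>2))"
    using u by (intro mult_mono mult_left_mono) auto
  also note small
  finally have "exp (9 / 4) * pi\<^sup>2 / 6 * u * exp (- \<delta>\<^sup>2 / (16 * u\<^sup>2 * \<eta>\<^sup>2)) * u \<le> \<eta> * u"
    using u by (intro mult_right_mono) auto
  moreover have "(\<Sum>j. gker \<eta> (v - ln (Suc j))) \<le> exp (9 / 4) * pi\<^sup>2 / 6 * u\<^sup>2 * exp (- \<delta>\<^sup>2 / (16 * u\<^sup>2 * \<eta>\<^sup>2))"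
    unfolding v using \<eta> \<delta> miss by (intro gker_sum_no_hit) (auto simp: u_def)
  ultimately have 1: "(\<Sum>j. gker \<eta> (v - ln (Suc j))) \<le> \<eta> * u"
    by (simp add: power2_eq_square mult_ac)
  \<comment> \<open>The mean is at least \<open>2 * \<eta> * u\<close>, while the sum over integers
    is at most \<open>\<eta> * u\<close>, so a deficit of \<open>\<eta> * u\<close> remains.\<close>
  have "sqrt 4 \<le> sqrt (2 * pi)" using pi_gt3 by (intro real_sqrt_le_mono) auto
  then have "2 * 1 \<le> sqrt (2 * pi) * exp (\<eta>\<^sup>2 / 8)" by (intro mult_mono) auto
  from mult_left_mono[OF this, of "u * \<eta>"] have 2: "u * \<eta> * 2 \<le> u * (\<eta> * sqrt (2 * pi) * exp (\<eta>\<^sup>2 / 8))"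
    using u \<eta> by (simp add: mult_ac)
  from 1 2 have "(\<Sum>j. gker \<eta> (v - ln (Suc j))) - u * (\<eta> * sqrt (2 * pi) * exp (\<eta>\<^sup>2 / 8)) \<le> - \<eta> * u"
    by (simp add: mult_ac)
  then have "hsum \<eta> v \<le> exp (- v / 2) * (- \<eta> * u)"
    unfolding hsum_def u_def by (intro mult_left_mono) auto
  also have "exp (- v / 2) * (- \<eta> * u) = - \<eta> * exp (v / 2)"
    by (simp add: u_def flip: exp_add)
  finally show ?thesis .
qed

text \<open>Where the whole block misses the positive integers, every summand of \<open>H\<close> is
  at most \<open>- \<eta> * sqrt (Z * exp (- A))\<close>, so nothing cancels and \<open>H\<close>
  lies below \<open>- m\<close>. Chebyshev's inequality with the mean square of \<open>H\<close>
  then bounds the set. The superset \<open>S\<close> is defined through the measurable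
  \<open>H\<close>, so measurability of the missing set itself is never at issue.\<close>

lemma no_hit_measure:
  fixes z :: "'i \<Rightarrow> real"
  assumes \<eta>: "\<eta> > 0" "\<eta> \<le> 1" and \<epsilon>: "\<epsilon> > 0" "\<epsilon> \<le> 1" and I: "finite I" "I \<noteq> {}"
    and zeta: "\<And>t. norm (zeta_halfplane (crit t)) \<le> K * (1 + \<bar>t\<bar>) powr \<epsilon>"
    and Z: "Z > 0" "\<And>i. i \<in> I \<Longrightarrow> Z \<le> z i" "\<And>i. i \<in> I \<Longrightarrow> z i \<le> 2 * Z"
    and \<delta>: "0 < \<delta>" "\<delta> \<le> Z * exp (- A)"
    and small: "exp (9 / 4) * pi\<^sup>2 / 6 * (2 * Z * exp A) * exp (- \<delta>\<^sup>2 / (16 * (2 * Z * exp A)\<^sup>2 * \<eta>\<^sup>2)) \<le> \<eta>"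
  shows "\<exists>S\<in>sets lborel. emeasure lborel S < \<infinity> \<and>
     {y \<in> {-A..A}. \<forall>i\<in>I. \<forall>j::nat. \<delta> \<le> \<bar>exp y * z i - real (Suc j)\<bar>} \<subseteq> S \<and>
     measure lborel S \<le> 4 * sqrt (2 * pi) * exp (A\<^sup>2 / 2 + A) * K\<^sup>2 * \<eta> powr (- 1 - 2 * \<epsilon>) / Z *
       (card {(i, j). i \<in> I \<and> j \<in> I \<and> \<bar>z i - z j\<bar> < 1} / (real (card I))\<^sup>2 + exp (- 1 / (8 * Z\<^sup>2 * \<eta>\<^sup>2)))"
proof -
  define q where "q = real (card I)"
  have q: "q > 0" using I by (simp add: q_def card_gt_0_iff)
  define H where "H y = (\<Sum>i\<in>I. hsum \<eta> (y + ln (z i)))" for y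
  define m where "m = q * \<eta> * sqrt (Z * exp (- A))"
  have m0: "m > 0" using q \<eta> Z by (simp add: m_def)
  define S where "S = {y \<in> {-A..A}. H y \<le> - m}"
  have zpos: "z i > 0" if "i \<in> I" for i using Z that by force
  have H_meas[measurable]: "H \<in> borel_measurable borel" unfolding H_def[abs_def] by measurable
  have S[measurable]: "S \<in> sets lborel" unfolding S_def by measurable
  have "emeasure lborel S \<le> emeasure lborel {-A..A}" by (rule emeasure_mono) (auto simp: S_def)
  also have "\<dots> < \<infinity>" by (simp add: emeasure_lborel_Icc_eq)
  finally have S_fin: "emeasure lborel S < \<infinity>" .
  have sub: "{y \<in> {-A..A}. \<forall>i\<in>I. \<forall>j::nat. \<delta> \<le> \<bar>exp y * z i - real (Suc j)\<bar>} \<subseteq> S"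
  proof
    fix y assume y: "y \<in> {y \<in> {-A..A}. \<forall>i\<in>I. \<forall>j::nat. \<delta> \<le> \<bar>exp y * z i - real (Suc j)\<bar>}"
    have "hsum \<eta> (y + ln (z i)) \<le> - \<eta> * sqrt (Z * exp (- A))" if i: "i \<in> I" for i
    proof -
      have ex: "exp (y + ln (z i)) = exp y * z i" using zpos[OF i] by (simp add: exp_add)
      have lo: "exp (- A) * Z \<le> exp y * z i" using y Z i by (intro mult_mono) auto
      have hi: "exp y * z i \<le> exp A * (2 * Z)" using y Z zpos[OF i] i by (intro mult_mono) auto
      have "hsum \<eta> (y + ln (z i)) \<le> - \<eta> * exp ((y + ln (z i)) / 2)"
      proof (rule hsum_no_hit[OF \<eta> \<delta>(1) _ _ _ small])
        show "\<delta> \<le> exp (y + ln (z i))" using \<delta> lo unfolding ex by (simp add: mult_ac)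
        show "exp (y + ln (z i)) \<le> 2 * Z * exp A" using hi unfolding ex by (simp add: mult_ac)
        show "\<delta> \<le> \<bar>exp (y + ln (z i)) - real (Suc j)\<bar>" for j using y i unfolding ex by blast
      qed
      also have "exp ((y + ln (z i)) / 2) = sqrt (exp (y + ln (z i)))"
        by (rule real_sqrt_unique[symmetric]) (simp_all flip: exp_double)
      also have "- \<eta> * sqrt (exp (y + ln (z i))) \<le> - \<eta> * sqrt (Z * exp (- A))"
        using lo \<eta> unfolding ex by (simp add: mult_ac)
      finally show ?thesis .
    qed
    then have "H y \<le> (\<Sum>i\<in>I. - \<eta> * sqrt (Z * exp (- A)))" unfolding H_def by (rule sum_mono)
    then show "y \<in> S" using y by (simp add: S_def m_def q_def mult_ac)
  qed
  define D where "D = (\<Sum>i\<in>I. \<Sum>j\<in>I. exp (- (ln (z i) - ln (z j))\<^sup>2 / (2 * \<eta>\<^sup>2)))"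
  note L2 = hsum_L2_bound[OF \<eta> \<epsilon> I(1) zeta, of "\<lambda>i. ln (z i)", folded H_def D_def]
  define E where "E = {(i, j). i \<in> I \<and> j \<in> I \<and> \<bar>z i - z j\<bar> < 1}"
  define w where "w = exp (- 1 / (8 * Z\<^sup>2 * \<eta>\<^sup>2))"
  \<comment> \<open>A pair contributes at most 1. If \<open>|z i - z j| \<ge> 1\<close>, then the
    logarithms differ by at least \<open>1 / (2 * Z)\<close> because both values lie below
    \<open>2 * Z\<close>, and the contribution is at most \<open>w\<close>.\<close>
  have "D \<le> (\<Sum>i\<in>I. \<Sum>j\<in>I. indicator E (i, j) + w)"
    unfolding D_def
  proof (intro sum_mono)
    fix i j assume ij: "i \<in> I" "j \<in> I"
    show "exp (- (ln (z i) - ln (z j))\<^sup>2 / (2 * \<eta>\<^sup>2)) \<le> indicator E (i, j) + w"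
    proof (cases "(i, j) \<in> E")
      case True
      then show ?thesis by (simp add: w_def add_increasing2)
    next
      case False
      then have "1 / (2 * Z) \<le> \<bar>z i - z j\<bar> / (2 * Z)"
        using ij Z(1) by (intro divide_right_mono) (auto simp: E_def)
      also have "\<dots> \<le> \<bar>ln (z i) - ln (z j)\<bar>"
        using ij Z zpos by (intro abs_ln_diff_ge) auto
      finally have "(1 / (2 * Z))\<^sup>2 \<le> \<bar>ln (z i) - ln (z j)\<bar>\<^sup>2"
        using Z(1) by (intro power_mono) auto
      then have "1 / (4 * Z\<^sup>2) / (2 * \<eta>\<^sup>2) \<le> (ln (z i) - ln (z j))\<^sup>2 / (2 * \<eta>\<^sup>2)"
        by (intro divide_right_mono) (simp_all add: power_divide power_mult_distrib)
      then show ?thesis using False by (simp add: w_def mult_ac)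
    qed
  qed
  also have "\<dots> = card E + q\<^sup>2 * w"
  proof -
    have "(\<Sum>i\<in>I. \<Sum>j\<in>I. indicator E (i, j) :: real) = (\<Sum>p\<in>I \<times> I. indicator E p)"
      by (simp add: sum.cartesian_product)
    also have "\<dots> = card E"
    proof -
      have "E \<subseteq> I \<times> I" by (auto simp: E_def)
      then show ?thesis using I by (simp add: indicator_def sum.If_cases Int_absorb1)
    qed
    finally show ?thesis by (simp add: sum.distrib q_def power2_eq_square)
  qed
  finally have D: "D \<le> card E + q\<^sup>2 * w" .
  have "m\<^sup>2 * exp (- A\<^sup>2 / 2) * measure lborel S = (LINT y|lborel. indicator S y * (m\<^sup>2 * exp (- A\<^sup>2 / 2)))"
    using S_fin S by simp
  also have "\<dots> \<le> (LINT y|lborel. (H y)\<^sup>2 * exp (- y\<^sup>2 / 2))"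
  proof (rule integral_mono[OF _ L2(1)])
    show "integrable lborel (\<lambda>y. indicator S y * (m\<^sup>2 * exp (- A\<^sup>2 / 2)))"
      by (rule integrable_mult_left, rule integrable_real_indicator[OF S S_fin])
    \<comment> \<open>On the window the Gaussian weight is at least
      \<open>exp (- A\<^sup>2 / 2)\<close>; this is the source of \<open>exp (A\<^sup>2 / 2)\<close>
      in the bound, the further \<open>exp A\<close> coming from \<open>m\<^sup>2\<close>.\<close>
    show "indicator S y * (m\<^sup>2 * exp (- A\<^sup>2 / 2)) \<le> (H y)\<^sup>2 * exp (- y\<^sup>2 / 2)" for y
    proof (cases "y \<in> S")
      case True
      then have "m\<^sup>2 \<le> (- H y)\<^sup>2" using m0 by (intro power_mono) (auto simp: S_def)
      moreover have "y\<^sup>2 \<le> A\<^sup>2" using True by (intro abs_le_square_iff[THEN iffD1]) (auto simp: S_def)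
      ultimately show ?thesis using True by (auto intro!: mult_mono)
    qed simp
  qed
  also have "\<dots> \<le> 4 * sqrt (2 * pi) * K\<^sup>2 * \<eta> powr (1 - 2 * \<epsilon>) * D" by (rule L2(2))
  also have "\<dots> \<le> 4 * sqrt (2 * pi) * K\<^sup>2 * \<eta> powr (1 - 2 * \<epsilon>) * (card E + q\<^sup>2 * w)"
    using D by (intro mult_left_mono) auto
  finally have "measure lborel S \<le> 4 * sqrt (2 * pi) * K\<^sup>2 * \<eta> powr (1 - 2 * \<epsilon>) * (card E + q\<^sup>2 * w) / (m\<^sup>2 * exp (- A\<^sup>2 / 2))"
    using m0 by (simp add: field_simps)
  also have "\<dots> = 4 * sqrt (2 * pi) * exp (A\<^sup>2 / 2 + A) * K\<^sup>2 * (\<eta> powr (1 - 2 * \<epsilon>) / \<eta>\<^sup>2) / Z * (card E / q\<^sup>2 + w)"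
    unfolding exp_add[of "A\<^sup>2 / 2" A] using q \<eta> Z(1)
    by (simp add: m_def power_mult_distrib exp_minus divide_simps)
  also have "\<eta> powr (1 - 2 * \<epsilon>) / \<eta>\<^sup>2 = \<eta> powr (- 1 - 2 * \<epsilon>)"
    using \<eta> powr_diff[of \<eta> "1 - 2 * \<epsilon>" 2] by simp
  finally show ?thesis
    using S S_fin sub unfolding E_def q_def w_def by blast
qed

section \<open>Minimal gaps and blocks of differences\<close>

lemma dist_nint_le: "dist_nint t \<le> \<bar>t - of_int k\<bar>"
  unfolding dist_nint_def by (rule cINF_lower) (auto intro!: bdd_belowI[of _ 0])

lemma dist_nint_nonneg: "0 \<le> dist_nint t"
  unfolding dist_nint_def by (rule cINF_greatest) auto

lemma dist_nint_le_half: "dist_nint t \<le> 1 / 2"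
  using dist_nint_le[of t "round t"] of_int_round_abs_le[of t] by (simp add: abs_minus_commute)

lemma delta_min_image:
  "delta_min x \<alpha> N = Min ((\<lambda>(m, n). dist_nint (\<alpha> * x m - \<alpha> * x n)) ` {(m, n). m \<in> {1..N} \<and> n \<in> {1..N} \<and> m \<noteq> n})"
  unfolding delta_min_def by (rule arg_cong[where f = Min]) auto

lemma finite_pairs: fixes N :: nat shows "finite {(m, n). m \<in> {1..N} \<and> n \<in> {1..N} \<and> R m n}"
  by (rule finite_subset[of _ "{1..N} \<times> {1..N}"]) auto

lemma delta_min_le:
  assumes "m \<in> {1..N}" "n \<in> {1..N}" "m \<noteq> n"
  shows "delta_min x \<alpha> N \<le> dist_nint (\<alpha> * x m - \<alpha> * x n)"
  unfolding delta_min_image using assms finite_pairs[of N "(\<noteq>)"]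
  by (intro Min_le finite_imageI) (auto intro!: image_eqI[of _ _ "(m, n)"])

text \<open>For \<open>N < 2\<close> there are no pairs and \<open>Min\<close> of the empty set is
  unspecified; hence the bound on \<open>N\<close> here and in the next facts.\<close>

lemma delta_min_nonneg:
  assumes "2 \<le> N" shows "0 \<le> delta_min x \<alpha> N"
proof -
  have "(1, 2) \<in> {(m, n). m \<in> {1..N} \<and> n \<in> {1..N} \<and> m \<noteq> n}" using assms by auto
  then show ?thesis
    unfolding delta_min_image
  proof (intro Min.boundedI finite_imageI finite_pairs)
    show "0 \<le> a" if "a \<in> (\<lambda>(m, n). dist_nint (\<alpha> * x m - \<alpha> * x n)) ` {(m, n). m \<in> {1..N} \<and> n \<in> {1..N} \<and> m \<noteq> n}" for a
      using that by (auto simp: dist_nint_nonneg)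
  qed blast
qed

lemma delta_min_le_half:
  assumes "2 \<le> N" shows "delta_min x \<alpha> N \<le> 1 / 2"
  using assms by (intro order.trans[OF delta_min_le[of 1 N 2] dist_nint_le_half]) auto

lemma delta_min_antimono:
  assumes "2 \<le> M" "M \<le> N" shows "delta_min x \<alpha> N \<le> delta_min x \<alpha> M"
proof -
  have "(1, 2) \<in> {(m, n). m \<in> {1..M} \<and> n \<in> {1..M} \<and> m \<noteq> n}" using assms by auto
  moreover have "{(m, n). m \<in> {1..M} \<and> n \<in> {1..M} \<and> m \<noteq> n} \<subseteq> {(m, n). m \<in> {1..N} \<and> n \<in> {1..N} \<and> m \<noteq> n}"
    using assms by auto
  ultimately show ?thesis
    unfolding delta_min_image by (intro Min_antimono image_mono finite_imageI finite_pairs) blast+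
qed

text \<open>Negating \<alpha> amounts to exchanging the two indices. This carries results for
  \<open>\<alpha> = exp y\<close> over to negative parameters.\<close>

lemma delta_min_uminus: "delta_min x (- \<alpha>) N = delta_min x \<alpha> N"
proof -
  have "(\<lambda>(m, n). dist_nint (- \<alpha> * x m - - \<alpha> * x n)) ` {(m, n). m \<in> {1..N} \<and> n \<in> {1..N} \<and> m \<noteq> n}
      = (\<lambda>(m, n). dist_nint (\<alpha> * x m - \<alpha> * x n)) ` prod.swap ` {(m, n). m \<in> {1..N} \<and> n \<in> {1..N} \<and> m \<noteq> n}"
    unfolding image_image by (rule image_cong) auto
  also have "prod.swap ` {(m, n). m \<in> {1..N} \<and> n \<in> {1..N} \<and> m \<noteq> n} = {(m, n). m \<in> {1..N} \<and> n \<in> {1..N} \<and> m \<noteq> n}"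
    by (auto simp: image_iff)
  finally show ?thesis unfolding delta_min_image by simp
qed

section \<open>Differences of a separated sequence of polynomial growth\<close>

lemma gap_diff:
  fixes x :: "nat \<Rightarrow> real"
  assumes "\<forall>n\<ge>1. x (Suc n) - x n \<ge> c" "c > 0" "1 \<le> n" "n < m"
  shows "c \<le> x m - x n"
  using assms(4)
proof (induction m)
  case (Suc m)
  show ?case
  proof (cases "n = m")
    case False
    then have "c \<le> x m - x n" using Suc by simp
    moreover have "c \<le> x (Suc m) - x m" using assms(1,3) Suc.prems by simp
    ultimately show ?thesis using assms(2) by linarith
  qed (use assms in auto)
qed simp

lemma card_ordered_pairs:
  "2 * card {(m, n). m \<in> {1..N} \<and> n \<in> {1..N} \<and> n < m} = N * (N - 1)"
proof -
  have "{(m, n). m \<in> {1..N} \<and> n \<in> {1..N} \<and> n < m} = (SIGMA m:{1..N}. {1..<m})" by auto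
  then have "card {(m, n). m \<in> {1..N} \<and> n \<in> {1..N} \<and> n < m} = (\<Sum>m\<in>{1..N}. m - 1)"
    by simp
  also have "2 * \<dots> = N * (N - 1)"
  proof (induction N)
    case (Suc N)
    then show ?case by (cases N) (auto simp: algebra_simps)
  qed simp
  finally show ?thesis .
qed

text \<open>The positive differences lie between \<open>c\<close> and \<open>K * N powr C\<close>,
  so logarithmically many dyadic blocks cover them and the pigeonhole principle finds one holding
  all but a logarithmic factor of the pairs.\<close>

lemma dyadic_block:
  fixes x :: "nat \<Rightarrow> real"
  assumes gap: "\<forall>n\<ge>1. x (Suc n) - x n \<ge> c" "c > 0" and pos: "\<forall>n\<ge>1. x n > 0"
    and poly: "\<forall>n\<ge>1. x n \<le> K * real n powr C" "K > 0" "C > 0" and N: "2 \<le> N"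
  shows "\<exists>Z I. c \<le> Z \<and> Z \<le> K * real N powr C \<and> I \<subseteq> {(m, n). m \<in> {1..N} \<and> n \<in> {1..N} \<and> n < m} \<and>
     (\<forall>(m, n)\<in>I. Z \<le> x m - x n \<and> x m - x n \<le> 2 * Z) \<and>
     (real N)\<^sup>2 / 4 \<le> card I * (log 2 (K * real N powr C / c) + 1)"
proof -
  define X where "X = K * real N powr C"
  define D where "D = {(m, n). m \<in> {1..N} \<and> n \<in> {1..N} \<and> n < m}"
  define f where "f = (\<lambda>(m, n). nat \<lfloor>log 2 ((x m - x n) / c)\<rfloor>)"
  define B where "B = nat \<lfloor>log 2 (X / c)\<rfloor>"
  have D: "finite D" unfolding D_def by (rule finite_pairs)
  have z: "c \<le> x m - x n" "x m - x n \<le> X" if "(m, n) \<in> D" for m n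
  proof -
    show "c \<le> x m - x n" using that gap by (intro gap_diff) (auto simp: D_def)
    have "real m powr C \<le> real N powr C" using that poly by (intro powr_mono2) (auto simp: D_def)
    then have "K * real m powr C \<le> X" using poly by (simp add: X_def)
    moreover have "x m \<le> K * real m powr C" using that poly by (simp add: D_def)
    ultimately have "x m \<le> X" by linarith
    moreover have "x n > 0" using that pos by (auto simp: D_def)
    ultimately show "x m - x n \<le> X" by simp
  qed
  have "(2, 1) \<in> D" using N by (simp add: D_def)
  with z have cX: "c \<le> X" by force
  have fB: "f \<in> D \<rightarrow> {..B}"
  proof
    fix p assume p: "p \<in> D"
    obtain m n where mn: "p = (m, n)" by force
    have "log 2 ((x m - x n) / c) \<le> log 2 (X / c)"
    proof -
      have "0 < x m - x n" "x m - x n \<le> X" using z[of m n] p gap unfolding mn by auto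
      then show ?thesis using gap cX by (subst log_le_cancel_iff) (auto intro!: divide_right_mono divide_pos_pos)
    qed
    then show "f p \<in> {..B}" by (auto simp: f_def B_def mn intro!: nat_mono floor_mono)
  qed
  obtain k where k: "k \<in> {..B}" "card D \<le> card (f -` {k} \<inter> D) * card {..B}"
    using pigeonhole_card[OF fB D] by auto
  define I where "I = f -` {k} \<inter> D"
  define Z where "Z = c * 2 ^ k"
  have "real k \<le> log 2 (X / c)"
  proof -
    have "0 \<le> log 2 (X / c)" using cX gap by (simp add: zero_le_log_cancel_iff)
    then have "real B \<le> log 2 (X / c)" unfolding B_def by linarith
    then show ?thesis using k by simp
  qed
  then have "2 powr real k \<le> X / c" using cX gap by (subst (asm) le_log_iff) auto
  then have ZX: "Z \<le> X" using gap by (simp add: Z_def powr_realpow field_simps)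
  have block: "Z \<le> x m - x n \<and> x m - x n \<le> 2 * Z" if "(m, n) \<in> I" for m n
  proof -
    have mn: "(m, n) \<in> D" and fk: "nat \<lfloor>log 2 ((x m - x n) / c)\<rfloor> = k"
      using that by (auto simp: I_def f_def)
    have pos: "0 < (x m - x n) / c" using z[OF mn] gap by (intro divide_pos_pos) auto
    have "0 \<le> log 2 ((x m - x n) / c)" using z[OF mn] gap by (simp add: zero_le_log_cancel_iff)
    then have "real k \<le> log 2 ((x m - x n) / c)" "log 2 ((x m - x n) / c) \<le> real (Suc k)"
      using fk by linarith+
    then have "2 powr real k \<le> (x m - x n) / c" "(x m - x n) / c \<le> 2 powr real (Suc k)"
      using pos by (simp_all only: le_log_iff log_le_iff one_less_numeral_iff semiring_norm(76))
    then show ?thesis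
      using gap powr_realpow[of 2 k] powr_realpow[of 2 "Suc k"] by (simp add: Z_def field_simps)
  qed
  \<comment> \<open>There are \<open>N (N - 1) / 2\<close> ordered pairs, and
    \<open>N - 1 \<ge> N / 2\<close> since \<open>2 \<le> N\<close>.\<close>
  have "(real N)\<^sup>2 / 4 \<le> card D"
  proof -
    have "2 * real (card D) = real N * (real N - 1)"
      using card_ordered_pairs[of N] N unfolding D_def[symmetric]
      by (metis (no_types, opaque_lifting) of_nat_mult of_nat_numeral of_nat_diff of_nat_1 one_le_numeral order.trans)
    moreover have "real N * (real N - 1) \<ge> real N * (real N / 2)"
      using N by (intro mult_left_mono) auto
    ultimately show ?thesis by (simp add: power2_eq_square)
  qed
  also have "real (card D) \<le> real (card I) * (real B + 1)"
    using k(2) unfolding I_def[symmetric] by (metis Suc_eq_plus1 card_atMost of_nat_1 of_nat_add of_nat_le_iff of_nat_mult)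
  also have "\<dots> \<le> real (card I) * (log 2 (X / c) + 1)"
  proof -
    have "0 \<le> log 2 (X / c)" using cX gap by (simp add: zero_le_log_cancel_iff)
    then have "real B \<le> log 2 (X / c)" unfolding B_def by linarith
    then show ?thesis by (intro mult_left_mono) auto
  qed
  finally have "(real N)\<^sup>2 / 4 \<le> card I * (log 2 (X / c) + 1)" .
  note card_I = this
  show ?thesis
  proof (intro exI conjI)
    show "c \<le> Z" using gap by (simp add: Z_def)
    show "Z \<le> K * real N powr C" using ZX by (simp add: X_def)
    show "I \<subseteq> {(m, n). m \<in> {1..N} \<and> n \<in> {1..N} \<and> n < m}" unfolding I_def D_def by (rule Int_lower2)
    show "\<forall>(m, n)\<in>I. Z \<le> x m - x n \<and> x m - x n \<le> 2 * Z" using block by (intro ballI) (simp add: split_def)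
    show "(real N)\<^sup>2 / 4 \<le> card I * (log 2 (K * real N powr C / c) + 1)" using card_I by (simp only: X_def)
  qed
qed

text \<open>The difference of two differences is \<open>x m + x n' - x m' - x n\<close>, so the
  injection sends \<open>((m, n), (m', n'))\<close> to \<open>(m, n', m', n)\<close>.\<close>

lemma card_close_le_add_energy:
  assumes "I \<subseteq> {(m, n). m \<in> {1..N} \<and> n \<in> {1..N} \<and> n < m}"
  shows "card {(i, j). i \<in> I \<and> j \<in> I \<and> \<bar>(case i of (m, n) \<Rightarrow> x m - x n) - (case j of (m, n) \<Rightarrow> x m - x n)\<bar> < 1}
     \<le> add_energy x N"
  unfolding add_energy_def
proof (rule card_inj_on_le)
  let ?h = "\<lambda>((m, n), (m', n')). (m, n', m', n)"
  show "inj_on ?h {(i, j). i \<in> I \<and> j \<in> I \<and> \<bar>(case i of (m, n) \<Rightarrow> x m - x n) - (case j of (m, n) \<Rightarrow> x m - x n)\<bar> < 1}"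
    by (rule inj_onI) auto
  show "?h ` {(i, j). i \<in> I \<and> j \<in> I \<and> \<bar>(case i of (m, n) \<Rightarrow> x m - x n) - (case j of (m, n) \<Rightarrow> x m - x n)\<bar> < 1}
     \<subseteq> {(n1, n2, n3, n4). n1 \<in> {1..N} \<and> n2 \<in> {1..N} \<and> n3 \<in> {1..N} \<and> n4 \<in> {1..N} \<and> \<bar>x n1 + x n2 - x n3 - x n4\<bar> < 1}"
    using assms by (auto simp: algebra_simps)
  show "finite {(n1, n2, n3, n4). n1 \<in> {1..N} \<and> n2 \<in> {1..N} \<and> n3 \<in> {1..N} \<and> n4 \<in> {1..N} \<and> \<bar>x n1 + x n2 - x n3 - x n4\<bar> < 1}"
    by (rule finite_subset[of _ "{1..N} \<times> {1..N} \<times> {1..N} \<times> {1..N}"]) auto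
qed

section \<open>Comparison of exponentials, logarithms and powers for large arguments\<close>

lemma eventually_exp_powr_le:
  fixes a b C p :: real
  assumes "a > 0" "b > 0"
  shows "\<forall>\<^sub>F N in sequentially. C * exp (- a * real N powr b) \<le> real N powr p"
  using assms by real_asymp

lemma eventually_log_le_powr:
  fixes K C c \<rho> :: real
  assumes "K > 0" "C > 0" "c > 0" "\<rho> > 0"
  shows "\<forall>\<^sub>F N in sequentially. log 2 (K * real N powr C / c) + 1 \<le> real N powr \<rho> / 4"
  using assms by real_asymp

lemma eventually_powr_minus_le:
  fixes a c :: real
  assumes "a > 0" "c > 0"
  shows "\<forall>\<^sub>F N in sequentially. real N powr (- a) \<le> c"
  using assms by real_asymp

section \<open>Almost every parameter\<close>

lemma delta_min_large_measure:
  fixes x :: "nat \<Rightarrow> real" and c \<beta> :: real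
  assumes LH: "lindelof_hypothesis"
    and pos: "\<forall>n\<ge>1. x n > 0" and c: "c > 0" and gap: "\<forall>n\<ge>1. x (Suc n) - x n \<ge> c"
    and poly: "\<forall>n\<ge>1. x n \<le> K * real n powr C" "1 \<le> K" "0 < C"
    and energy: "\<forall>\<epsilon>>0. \<exists>K. \<forall>N\<ge>1. real (add_energy x N) \<le> K * real N powr (\<beta> + \<epsilon>)"
    and e: "e > 0" and \<kappa>: "\<kappa> = 4 - \<beta> - e" "\<kappa> > 0"
  shows "\<exists>M. \<forall>\<^sub>F N in sequentially. \<exists>S\<in>sets lborel. emeasure lborel S < \<infinity> \<and>
     {y \<in> {-A..A}. real N powr (- \<kappa>) \<le> delta_min x (exp y) N} \<subseteq> S \<and>
     measure lborel S \<le> M * real N powr (- e / 2)"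
proof -
  \<comment> \<open>Budget for the loss \<open>e\<close>: one \<open>\<rho>\<close> goes to the
    width \<open>\<eta>\<close>, one to the energy bound and two to the square of the block size, in
    total \<open>e / 4\<close>; another \<open>e / 4\<close> pays for the Lindelof factor, and
    \<open>e / 2\<close> is left over.\<close>
  define \<rho> where "\<rho> = e / 16"
  \<comment> \<open>This is the exponent with \<open>1 / \<eta> \<le> K * N powr B\<close> for the
    width chosen below. The choice of \<open>\<epsilon>\<close> then keeps
    \<open>\<eta> powr (- 2 * \<epsilon>)\<close> below \<open>K\<^sup>2 * N powr (e / 4)\<close>;
    the cap at 1 is the one required by \<open>powr_le_gauss\<close>.\<close>
  define B where "B = C + \<rho> + \<kappa>"
  define \<epsilon> where "\<epsilon> = min 1 (e / (8 * B))"
  have \<rho>: "\<rho> > 0" and B: "B > 0" using e \<kappa> poly by (simp_all add: \<rho>_def B_def)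
  have \<epsilon>: "\<epsilon> > 0" "\<epsilon> \<le> 1" using e B by (simp_all add: \<epsilon>_def)
  have "\<epsilon> \<le> e / (8 * B)" by (simp add: \<epsilon>_def)
  then have \<epsilon>B: "2 * \<epsilon> * B \<le> e / 4" using B by (simp add: field_simps)
  obtain Kz where Kz: "\<And>t. norm (zeta_halfplane (crit t)) \<le> Kz * (1 + \<bar>t\<bar>) powr \<epsilon>"
    using LH \<epsilon> unfolding lindelof_hypothesis_def by blast
  obtain K2 where K2: "\<And>N. N \<ge> 1 \<Longrightarrow> real (add_energy x N) \<le> K2 * real N powr (\<beta> + \<rho>)"
    using energy \<rho> by blast
  have K2_nonneg: "0 \<le> K2" using order.trans[OF of_nat_0_le_iff K2[of 1]] by simp
  define M where "M = 4 * sqrt (2 * pi) * exp (A\<^sup>2 / 2 + A) * Kz\<^sup>2 * (K\<^sup>2 * (K2 + 1))"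
  \<comment> \<open>For \<open>\<eta> = \<delta> / (Z * L)\<close> the exponential in the smallness
    condition is \<open>exp (- a * L\<^sup>2)\<close>, where 64 = 16 * 4. The constant
    \<open>c1\<close> collects its prefactors: one \<open>Z\<close> stands there explicitly, a
    second comes from the denominator of \<open>\<eta>\<close>, and together they are at most
    \<open>K\<^sup>2 * N powr (2 * C)\<close>.\<close>
  define c1 where "c1 = exp (9 / 4) * pi\<^sup>2 / 6 * (2 * exp A) * K\<^sup>2"
  define a where "a = 1 / (64 * (exp A)\<^sup>2)"
  have a: "a > 0" by (simp add: a_def)
  have evs: "\<forall>\<^sub>F N in sequentially. real N powr (- (\<kappa> + \<rho>)) \<le> c"
    "\<forall>\<^sub>F N in sequentially. real N powr (- \<kappa>) \<le> c * exp (- A)"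
    "\<forall>\<^sub>F N in sequentially. c1 * exp (- a * real N powr (2 * \<rho>)) \<le> real N powr (- \<kappa> - \<rho> - 2 * C)"
    "\<forall>\<^sub>F N in sequentially. log 2 (K * real N powr C / c) + 1 \<le> real N powr \<rho> / 4"
    "\<forall>\<^sub>F N in sequentially. 1 * exp (- (1 / 8) * real N powr (2 * \<rho> + 2 * \<kappa>)) \<le> real N powr (\<beta> + 3 * \<rho> - 4)"
    by ((rule eventually_powr_minus_le eventually_exp_powr_le eventually_log_le_powr;
        use \<kappa>(2) \<rho> c poly(2,3) a in simp))+
  have "\<forall>\<^sub>F N in sequentially. \<exists>S\<in>sets lborel. emeasure lborel S < \<infinity> \<and>
     {y \<in> {-A..A}. real N powr (- \<kappa>) \<le> delta_min x (exp y) N} \<subseteq> S \<and>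
     measure lborel S \<le> M * real N powr (- e / 2)"
    using eventually_ge_at_top[of 2] evs
  proof eventually_elim
    case (elim N)
    define n where "n = real N"
    have n: "n \<ge> 2" using elim(1) by (simp add: n_def)
    have ev_a: "n powr (- (\<kappa> + \<rho>)) \<le> c" using elim(2) by (simp only: n_def)
    have ev_b: "n powr (- \<kappa>) \<le> c * exp (- A)" using elim(3) by (simp only: n_def)
    have ev_c: "c1 * exp (- a * n powr (2 * \<rho>)) \<le> n powr (- \<kappa> - \<rho> - 2 * C)" using elim(4) by (simp only: n_def)
    have ev_d: "log 2 (K * n powr C / c) + 1 \<le> n powr \<rho> / 4" using elim(5) by (simp only: n_def)
    have ev_e: "exp (- (1 / 8) * n powr (2 * \<rho> + 2 * \<kappa>)) \<le> n powr (\<beta> + 3 * \<rho> - 4)"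
      using elim(6) by (simp only: n_def mult_1)
    obtain Z I where cZ: "c \<le> Z" and ZX: "Z \<le> K * n powr C"
      and I: "I \<subseteq> {(m, n). m \<in> {1..N} \<and> n \<in> {1..N} \<and> n < m}"
      and block: "\<forall>(m, n)\<in>I. Z \<le> x m - x n \<and> x m - x n \<le> 2 * Z"
      and card_I: "n\<^sup>2 / 4 \<le> card I * (log 2 (K * n powr C / c) + 1)"
      using dyadic_block[OF gap c pos poly(1) _ poly(3) elim(1)] poly(2) unfolding n_def by auto
    define \<delta> where "\<delta> = n powr (- \<kappa>)"
    define L where "L = n powr \<rho>"
    \<comment> \<open>Missing an integer by \<open>\<delta>\<close> at height about \<open>Z\<close>
      moves the logarithm by a constant times \<open>\<delta> / Z\<close>. Taking
      \<open>\<eta>\<close> smaller by the factor \<open>L\<close> places every integer about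
      \<open>L\<close> widths away, so the Gaussian count decays faster than any power of
      \<open>N\<close>.\<close>
    define \<eta> where "\<eta> = \<delta> / (Z * L)"
    have Z: "Z > 0" using cZ c by simp
    have L: "L > 0" and \<delta>: "\<delta> > 0" using n by (simp_all add: L_def \<delta>_def)
    have \<eta>_pos: "\<eta> > 0" using Z L \<delta> by (simp add: \<eta>_def)
    have \<delta>L: "\<delta> / L = n powr (- (\<kappa> + \<rho>))" using n by (simp add: \<delta>_def L_def flip: powr_diff)
    have \<eta>_eq: "\<eta> = \<delta> / L / Z" by (simp add: \<eta>_def)
    have \<eta>_le: "\<eta> \<le> 1" unfolding \<eta>_eq \<delta>L using ev_a cZ Z by simp
    have L2: "L\<^sup>2 = n powr (2 * \<rho>)" using n by (simp add: L_def power2_eq_square flip: powr_add)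
    have fin_I: "finite I" using I finite_pairs by (rule finite_subset)
    define q where "q = real (card I)"
    have q: "n powr (2 - \<rho>) \<le> q"
    proof -
      have "n\<^sup>2 / 4 \<le> q * (n powr \<rho> / 4)"
        using card_I mult_left_mono[OF ev_d, of q] by (simp add: q_def)
      then have "n powr 2 \<le> q * n powr \<rho>" using n by simp
      then show ?thesis using n by (simp add: powr_diff field_simps)
    qed
    have q_pos: "q > 0" using less_le_trans[OF _ q, of 0] n by simp
    then have I_ne: "I \<noteq> {}" by (auto simp: q_def)
    define z where "z = (\<lambda>(m, n). x m - x n)"
    have small: "exp (9 / 4) * pi\<^sup>2 / 6 * (2 * Z * exp A) * exp (- \<delta>\<^sup>2 / (16 * (2 * Z * exp A)\<^sup>2 * \<eta>\<^sup>2)) \<le> \<eta>"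
    proof -
      have "- \<delta>\<^sup>2 / (16 * (2 * Z * exp A)\<^sup>2 * \<eta>\<^sup>2) = - a * n powr (2 * \<rho>)"
        unfolding L2[symmetric] a_def \<eta>_def using Z L \<delta> by (simp add: power_mult_distrib power_divide)
      moreover have "exp (9 / 4) * pi\<^sup>2 / 6 * (2 * Z * exp A) * exp (- a * n powr (2 * \<rho>)) \<le> \<delta> / L / Z"
      proof -
        have "exp (9 / 4) * pi\<^sup>2 / 6 * (2 * Z * exp A) * exp (- a * n powr (2 * \<rho>)) * Z
           = exp (9 / 4) * pi\<^sup>2 / 6 * (2 * exp A) * exp (- a * n powr (2 * \<rho>)) * Z\<^sup>2"
          by (simp add: power2_eq_square)
        also have "\<dots> \<le> exp (9 / 4) * pi\<^sup>2 / 6 * (2 * exp A) * exp (- a * n powr (2 * \<rho>)) * (K * n powr C)\<^sup>2"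
          using ZX Z by (intro mult_left_mono power_mono) auto
        also have "\<dots> = c1 * exp (- a * n powr (2 * \<rho>)) * n powr (2 * C)"
          using n by (simp add: c1_def power_mult_distrib power2_eq_square powr_add[of n C C, symmetric])
        also have "\<dots> \<le> n powr (- \<kappa> - \<rho> - 2 * C) * n powr (2 * C)"
          by (rule mult_right_mono[OF ev_c]) simp
        also have "\<dots> = \<delta> / L" unfolding \<delta>L powr_add[symmetric] by simp
        finally show ?thesis by (simp only: pos_le_divide_eq[OF Z])
      qed
      ultimately show ?thesis unfolding \<eta>_eq by simp
    qed
    have "\<exists>S\<in>sets lborel. emeasure lborel S < \<infinity> \<and>
     {y \<in> {-A..A}. \<forall>i\<in>I. \<forall>j::nat. \<delta> \<le> \<bar>exp y * z i - real (Suc j)\<bar>} \<subseteq> S \<and>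
     measure lborel S \<le> 4 * sqrt (2 * pi) * exp (A\<^sup>2 / 2 + A) * Kz\<^sup>2 * \<eta> powr (- 1 - 2 * \<epsilon>) / Z *
       (card {(i, j). i \<in> I \<and> j \<in> I \<and> \<bar>z i - z j\<bar> < 1} / (real (card I))\<^sup>2 + exp (- 1 / (8 * Z\<^sup>2 * \<eta>\<^sup>2)))"
    proof (rule no_hit_measure[OF \<eta>_pos \<eta>_le \<epsilon> fin_I I_ne Kz Z _ _ \<delta> _ small])
      show "Z \<le> z i" "z i \<le> 2 * Z" if "i \<in> I" for i
        using that block by (auto simp: z_def)
      show "\<delta> \<le> Z * exp (- A)"
        unfolding \<delta>_def by (rule order.trans[OF ev_b mult_right_mono[OF cZ]]) simp
    qed
    then obtain S where S: "S \<in> sets lborel" "emeasure lborel S < \<infinity>"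
      and sub: "{y \<in> {-A..A}. \<forall>i\<in>I. \<forall>j::nat. \<delta> \<le> \<bar>exp y * z i - real (Suc j)\<bar>} \<subseteq> S"
      and meas: "measure lborel S \<le> 4 * sqrt (2 * pi) * exp (A\<^sup>2 / 2 + A) * Kz\<^sup>2 * \<eta> powr (- 1 - 2 * \<epsilon>) / Z *
       (card {(i, j). i \<in> I \<and> j \<in> I \<and> \<bar>z i - z j\<bar> < 1} / q\<^sup>2 + exp (- 1 / (8 * Z\<^sup>2 * \<eta>\<^sup>2)))"
      unfolding q_def by blast
    have "{y \<in> {-A..A}. real N powr (- \<kappa>) \<le> delta_min x (exp y) N} \<subseteq> S"
    proof (rule order.trans[OF _ sub], rule subsetI)
      fix y assume y: "y \<in> {y \<in> {-A..A}. real N powr (- \<kappa>) \<le> delta_min x (exp y) N}"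
      have "\<delta> \<le> \<bar>exp y * z i - real (Suc j)\<bar>" if i: "i \<in> I" for i j
      proof -
        obtain m k where mk: "i = (m, k)" by force
        have "\<delta> \<le> delta_min x (exp y) N" using y by (simp add: \<delta>_def n_def)
        also have "\<dots> \<le> dist_nint (exp y * x m - exp y * x k)"
          using i I unfolding mk by (intro delta_min_le) auto
        also have "\<dots> \<le> \<bar>exp y * x m - exp y * x k - of_int (int (Suc j))\<bar>" by (rule dist_nint_le)
        finally show ?thesis by (simp add: mk z_def right_diff_distrib)
      qed
      then show "y \<in> {y \<in> {-A..A}. \<forall>i\<in>I. \<forall>j::nat. \<delta> \<le> \<bar>exp y * z i - real (Suc j)\<bar>}"
        using y by blast
    qed
    moreover have "measure lborel S \<le> M * real N powr (- e / 2)"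
    proof -
      \<comment> \<open>\<open>Y\<close> is \<open>1 / \<eta>\<close>. In
        \<open>\<eta> powr (- 1 - 2 * \<epsilon>) / Z\<close> the first power of \<open>Y\<close>
        cancels \<open>Z\<close>, and only \<open>Y powr (2 * \<epsilon>)\<close> still depends on
        the block.\<close>
      define Y where "Y = Z * n powr (\<rho> + \<kappa>)"
      have Y: "Y > 0" using Z n by (simp add: Y_def)
      have \<eta>Y: "\<eta> = inverse Y"
        unfolding \<eta>_eq \<delta>L Y_def add.commute[of \<kappa> \<rho>] powr_minus by (simp add: divide_inverse)
      have "Y \<le> K * n powr B"
      proof -
        have "Y \<le> K * n powr C * n powr (\<rho> + \<kappa>)"
          unfolding Y_def using ZX by (intro mult_right_mono) auto
        also have "\<dots> = K * n powr B" by (simp add: B_def powr_add mult_ac)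
        finally show ?thesis .
      qed
      then have "Y powr (2 * \<epsilon>) \<le> (K * n powr B) powr (2 * \<epsilon>)"
        using Y \<epsilon> by (intro powr_mono2) auto
      also have "\<dots> = K powr (2 * \<epsilon>) * n powr (2 * \<epsilon> * B)"
        using poly n by (simp add: powr_mult powr_powr mult_ac)
      also have "\<dots> \<le> K powr 2 * n powr (e / 4)"
        using poly n \<epsilon> \<epsilon>B by (intro mult_mono powr_mono) auto
      also have "K powr 2 = K\<^sup>2" using poly by simp
      finally have Y2: "Y powr (2 * \<epsilon>) \<le> K\<^sup>2 * n powr (e / 4)" .
      have "\<eta> powr (- 1 - 2 * \<epsilon>) = Y powr (1 + 2 * \<epsilon>)"
        using Y by (simp add: \<eta>Y powr_minus powr_diff powr_add inverse_powr divide_inverse)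
      also have "\<dots> = Y * Y powr (2 * \<epsilon>)" using Y by (simp add: powr_add)
      finally have "\<eta> powr (- 1 - 2 * \<epsilon>) / Z = n powr (\<rho> + \<kappa>) * Y powr (2 * \<epsilon>)"
        using Z by (simp add: Y_def)
      also have "\<dots> \<le> n powr (\<rho> + \<kappa>) * (K\<^sup>2 * n powr (e / 4))"
        by (rule mult_left_mono[OF Y2]) simp
      also have "\<dots> = K\<^sup>2 * n powr (\<rho> + \<kappa> + e / 4)" by (simp add: powr_add mult_ac)
      finally have 1: "\<eta> powr (- 1 - 2 * \<epsilon>) / Z \<le> K\<^sup>2 * n powr (\<rho> + \<kappa> + e / 4)" .
      have "real (card {(i, j). i \<in> I \<and> j \<in> I \<and> \<bar>z i - z j\<bar> < 1}) \<le> real (add_energy x N)"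
        unfolding z_def of_nat_le_iff by (rule card_close_le_add_energy[OF I])
      also have "\<dots> \<le> K2 * n powr (\<beta> + \<rho>)" using K2[of N] elim(1) by (simp add: n_def)
      finally have "real (card {(i, j). i \<in> I \<and> j \<in> I \<and> \<bar>z i - z j\<bar> < 1}) / q\<^sup>2
         \<le> K2 * n powr (\<beta> + \<rho>) / (n powr (2 - \<rho>))\<^sup>2"
        using q q_pos n K2_nonneg by (intro frac_le power_mono) auto
      also have "\<dots> = K2 * n powr (\<beta> + 3 * \<rho> - 4)"
      proof -
        have "(n powr (2 - \<rho>))\<^sup>2 = n powr (4 - 2 * \<rho>)" using n by (simp add: power2_eq_square flip: powr_add)
        moreover have "n powr (\<beta> + \<rho>) / n powr (4 - 2 * \<rho>) = n powr (\<beta> + 3 * \<rho> - 4)"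
          unfolding powr_diff[symmetric] by (simp add: algebra_simps)
        ultimately show ?thesis by (simp only: times_divide_eq_right[symmetric])
      qed
      finally have 2: "real (card {(i, j). i \<in> I \<and> j \<in> I \<and> \<bar>z i - z j\<bar> < 1}) / q\<^sup>2 \<le> K2 * n powr (\<beta> + 3 * \<rho> - 4)" .
      \<comment> \<open>The product \<open>Z * \<eta>\<close> equals
        \<open>n powr (- \<rho> - \<kappa>)\<close> whatever the block is. Pairs at distance at
        least 1 are therefore many widths apart, and their contribution is exponentially
        small.\<close>
      have "1 / (8 * Z\<^sup>2 * \<eta>\<^sup>2) = 1 / 8 * n powr (2 * \<rho> + 2 * \<kappa>)"
      proof -
        have "1 / (8 * Z\<^sup>2 * \<eta>\<^sup>2) = 1 / 8 * (n powr (\<rho> + \<kappa>))\<^sup>2"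
          using Z Y by (simp add: \<eta>Y Y_def power_mult_distrib field_simps)
        then show ?thesis using n by (simp add: power2_eq_square algebra_simps flip: powr_add)
      qed
      have 3: "exp (- 1 / (8 * Z\<^sup>2 * \<eta>\<^sup>2)) \<le> n powr (\<beta> + 3 * \<rho> - 4)"
      proof -
        have "- 1 / (8 * Z\<^sup>2 * \<eta>\<^sup>2) = - (1 / (8 * Z\<^sup>2 * \<eta>\<^sup>2))" by simp
        also have "\<dots> = - (1 / 8) * n powr (2 * \<rho> + 2 * \<kappa>)"
          unfolding \<open>1 / (8 * Z\<^sup>2 * \<eta>\<^sup>2) = 1 / 8 * n powr (2 * \<rho> + 2 * \<kappa>)\<close> by simp
        finally show ?thesis using ev_e by (simp only:)
      qed
      define D where "D = 4 * sqrt (2 * pi) * exp (A\<^sup>2 / 2 + A) * Kz\<^sup>2"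
      have D: "0 \<le> D" by (simp add: D_def)
      have "measure lborel S \<le> D * ((\<eta> powr (- 1 - 2 * \<epsilon>) / Z) *
        (card {(i, j). i \<in> I \<and> j \<in> I \<and> \<bar>z i - z j\<bar> < 1} / q\<^sup>2 + exp (- 1 / (8 * Z\<^sup>2 * \<eta>\<^sup>2))))"
        using meas by (simp add: D_def mult_ac)
      also have "\<dots> \<le> D * ((K\<^sup>2 * n powr (\<rho> + \<kappa> + e / 4)) * (K2 * n powr (\<beta> + 3 * \<rho> - 4) + n powr (\<beta> + 3 * \<rho> - 4)))"
        by (intro mult_left_mono mult_mono add_mono 1 2 3 D) auto
      also have "\<dots> = M * (n powr (\<rho> + \<kappa> + e / 4) * n powr (\<beta> + 3 * \<rho> - 4))"
        by (simp add: M_def D_def algebra_simps)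
      \<comment> \<open>The exponents add up to \<open>\<kappa> + \<beta> - 4 + 4 * \<rho> + e / 4 =
        - e + e / 4 + e / 4\<close>.\<close>
      also have "n powr (\<rho> + \<kappa> + e / 4) * n powr (\<beta> + 3 * \<rho> - 4) = n powr (- e / 2)"
        unfolding powr_add[symmetric] by (rule arg_cong[where f = "(powr) n"]) (simp add: \<kappa>(1) \<rho>_def)
      finally show ?thesis by (simp add: n_def)
    qed
    ultimately show ?case using S by blast
  qed
  then show ?thesis by blast
qed

text \<open>The exceptional measures decay only like a small negative power of \<open>N\<close>,
  which need not be summable over all \<open>N\<close>; along powers of two they are dominated by a
  geometric series, as Borel-Cantelli requires.\<close>

lemma delta_min_dyadic_AE:
  fixes x :: "nat \<Rightarrow> real" and c \<beta> :: real
  assumes LH: "lindelof_hypothesis"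
    and pos: "\<forall>n\<ge>1. x n > 0" and c: "c > 0" and gap: "\<forall>n\<ge>1. x (Suc n) - x n \<ge> c"
    and poly: "\<forall>n\<ge>1. x n \<le> K * real n powr C" "1 \<le> K" "0 < C"
    and energy: "\<forall>\<epsilon>>0. \<exists>K. \<forall>N\<ge>1. real (add_energy x N) \<le> K * real N powr (\<beta> + \<epsilon>)"
    and e: "e > 0" and \<kappa>: "\<kappa> = 4 - \<beta> - e" "\<kappa> > 0"
  shows "AE y in lborel. y \<in> {-A..A} \<longrightarrow> (\<forall>\<^sub>F k in sequentially. delta_min x (exp y) (2 ^ k) < (2 ^ k) powr (- \<kappa>))"
proof -
  define good where "good M N S \<longleftrightarrow> S \<in> sets lborel \<and> emeasure lborel S < \<infinity> \<and>
     {y \<in> {-A..A}. real N powr (- \<kappa>) \<le> delta_min x (exp y) N} \<subseteq> S \<and>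
     measure lborel S \<le> M * real N powr (- e / 2)" for M N S
  obtain M N0 where "\<forall>N\<ge>N0. \<exists>S. good M N S"
    using delta_min_large_measure[OF assms, of A] unfolding eventually_sequentially good_def Bex_def by blast
  then obtain S where good: "\<And>N. N \<ge> N0 \<Longrightarrow> good M N (S N)" by metis
  have S: "S N \<in> sets lborel" "emeasure lborel (S N) < \<infinity>"
    "{y \<in> {-A..A}. real N powr (- \<kappa>) \<le> delta_min x (exp y) N} \<subseteq> S N"
    "measure lborel (S N) \<le> M * real N powr (- e / 2)" if "N \<ge> N0" for N
    using good[OF that] by (simp_all only: good_def)
  \<comment> \<open>Below the threshold \<open>N0\<close> no exceptional set is available; the empty
    set there makes the hypotheses hold for every \<open>k\<close> and does not affect the eventual
    conclusion.\<close>
  define T where "T k = (if 2 ^ k \<ge> N0 then S (2 ^ k) else {})" for k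
  have "AE y in lborel. \<forall>\<^sub>F k in sequentially. y \<in> space lborel - T k"
  proof (rule borel_cantelli_AE1)
    show "T k \<in> sets lborel" for k using S(1) by (simp add: T_def)
    show "emeasure lborel (T k) < \<infinity>" for k using S(2) by (simp add: T_def)
    have sm: "summable (\<lambda>k. \<bar>M\<bar> * (2 powr (- e / 2)) ^ k)"
      using e by (intro summable_mult summable_geometric) (simp add: powr_less_one)
    have le: "norm (measure lborel (T k)) \<le> \<bar>M\<bar> * (2 powr (- e / 2)) ^ k" for k
    proof (cases "2 ^ k \<ge> N0")
      case True
      have eq: "real (2 ^ k) powr (- e / 2) = (2 powr (- e / 2)) ^ k"
        by (simp add: powr_powr powr_realpow[symmetric] mult_ac)
      have "measure lborel (T k) \<le> M * (2 powr (- e / 2)) ^ k"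
        using S(4)[OF True] True unfolding eq by (simp add: T_def)
      also have "\<dots> \<le> \<bar>M\<bar> * (2 powr (- e / 2)) ^ k" by (intro mult_right_mono) auto
      finally show ?thesis by simp
    qed (simp add: T_def)
    show "summable (\<lambda>k. measure lborel (T k))"
      by (rule summable_comparison_test'[OF sm le])
  qed
  then show ?thesis
  proof eventually_elim
    case (elim y)
    have "\<forall>\<^sub>F k in sequentially. N0 \<le> 2 ^ k"
      by (rule eventually_sequentiallyI[of N0]) (meson le_trans less_exp less_imp_le_nat)
    with elim have "\<forall>\<^sub>F k in sequentially. y \<notin> S (2 ^ k) \<and> N0 \<le> 2 ^ k"
      by eventually_elim (simp add: T_def)
    then have "\<forall>\<^sub>F k in sequentially. y \<in> {-A..A} \<longrightarrow> delta_min x (exp y) (2 ^ k) < (2 ^ k) powr (- \<kappa>)"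
      by eventually_elim (use S(3) in \<open>force simp: not_le[symmetric]\<close>)
    then show ?case by (auto elim: eventually_mono)
  qed
qed

lemma AE_exp_imp_AE_even:
  assumes AE: "AE y in lborel. P (exp y)" and even: "\<And>\<alpha>::real. P (- \<alpha>) \<longleftrightarrow> P \<alpha>"
  shows "AE \<alpha> in lborel. P \<alpha>"
proof -
  define N where "N = {y. \<not> P (exp y)}"
  from AE obtain N' where "N' \<in> null_sets lborel" "N \<subseteq> N'"
    unfolding eventually_ae_filter N_def by auto
  then have "negligible N"
    by (meson negligible_iff_null_sets negligible_subset null_sets_completionI)
  have "exp differentiable_on S" "uminus differentiable_on S" for S :: "real set"
    by (auto simp: differentiable_on_def real_differentiable_def
        intro!: exI has_field_derivative_at_within[OF DERIV_exp] derivative_intros)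
  with \<open>negligible N\<close> have neg: "negligible (exp ` N)" "negligible (uminus ` exp ` N)"
    by (simp_all add: negligible_differentiable_image_negligible)
  have "{\<alpha>. \<not> P \<alpha>} \<subseteq> exp ` N \<union> uminus ` exp ` N \<union> {0}"
  proof
    fix \<alpha> assume \<alpha>: "\<alpha> \<in> {\<alpha>. \<not> P \<alpha>}"
    consider "\<alpha> > 0" | "\<alpha> < 0" | "\<alpha> = 0" by linarith
    then show "\<alpha> \<in> exp ` N \<union> uminus ` exp ` N \<union> {0}"
    proof cases
      case 1
      then have "\<alpha> = exp (ln \<alpha>)" "ln \<alpha> \<in> N" using \<alpha> by (auto simp: N_def)
      then show ?thesis by blast
    next
      case 2
      then have "\<alpha> = - exp (ln (- \<alpha>))" "ln (- \<alpha>) \<in> N" using \<alpha> even by (auto simp: N_def)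
      then show ?thesis by blast
    qed simp
  qed
  then have "negligible {\<alpha>. \<not> P \<alpha>}"
    using neg by (meson negligible_Un negligible_sing negligible_subset)
  then have "AE \<alpha> in lebesgue. P \<alpha>"
    unfolding eventually_ae_filter negligible_iff_null_sets by (auto intro!: bexI[of _ "{\<alpha>. \<not> P \<alpha>}"])
  then show ?thesis by (simp add: AE_completion_iff)
qed

text \<open>For \<open>2 ^ k \<le> N < 2 ^ (k + 1)\<close>, monotonicity transfers the bound from
  \<open>2 ^ k\<close> to \<open>N\<close>. Replacing \<open>2 ^ k\<close> by \<open>N\<close> on
  the right costs at most \<open>2 powr \<bar>\<kappa>\<bar>\<close>, which \<open>N powr e\<close>
  eventually exceeds.\<close>

lemma eventually_dyadic_antimono:
  fixes d :: "nat \<Rightarrow> real"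
  assumes anti: "\<And>M N. 2 \<le> M \<Longrightarrow> M \<le> N \<Longrightarrow> d N \<le> d M"
    and dy: "\<forall>\<^sub>F k in sequentially. d (2 ^ k) < (2 ^ k) powr (- \<kappa>)" and e: "e > 0"
  shows "\<forall>\<^sub>F N in sequentially. d N < real N powr (- \<kappa> + e)"
proof -
  obtain k0 where k0: "\<And>k. k \<ge> k0 \<Longrightarrow> d (2 ^ k) < (2 ^ k) powr (- \<kappa>)"
    using dy unfolding eventually_sequentially by blast
  have "\<forall>\<^sub>F N in sequentially. 2 powr \<bar>\<kappa>\<bar> \<le> real N powr e"
    using e by real_asymp
  moreover have "\<forall>\<^sub>F N in sequentially. 2 ^ (k0 + 1) \<le> N"
    by (rule eventually_ge_at_top)
  ultimately show ?thesis
  proof eventually_elim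
    case (elim N)
    have N: "N > 0" using elim(2) by (rule less_le_trans[rotated]) simp
    obtain k where k: "2 ^ k \<le> N" "N < 2 ^ (k + 1)"
      using ex_power_ivl1[of 2 N] N by auto
    have "k0 + 1 < k + 1"
      using k(2) elim(2) by (meson le_less_trans one_less_numeral_iff power_less_imp_less_exp semiring_norm(76))
    then have kk: "k0 \<le> k" "1 \<le> k" by auto
    have "(2::nat) ^ 1 \<le> 2 ^ k" using kk(2) by (rule power_increasing) simp
    then have "d N \<le> d (2 ^ k)" using k(1) by (intro anti) auto
    also have "\<dots> < (2 ^ k) powr (- \<kappa>)" using kk(1) by (rule k0)
    also have "\<dots> \<le> 2 powr \<bar>\<kappa>\<bar> * real N powr (- \<kappa>)"
    \<comment> \<open>The sign of \<open>\<kappa>\<close> decides whether the comparison needs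
      \<open>N / 2 \<le> 2 ^ k\<close> or \<open>2 ^ k \<le> N\<close>; negative values do occur
      when \<open>\<beta>\<close> is large.\<close>
    proof (cases "\<kappa> \<ge> 0")
      case True
      have "real N / 2 \<le> 2 ^ k" using k(2) by (simp flip: of_nat_less_iff[where 'a = real])
      then have "(2 ^ k) powr (- \<kappa>) \<le> (real N / 2) powr (- \<kappa>)"
        using True N by (intro powr_mono2') auto
      also have "\<dots> = 2 powr \<bar>\<kappa>\<bar> * real N powr (- \<kappa>)"
        using True N by (simp add: powr_divide powr_minus field_simps)
      finally show ?thesis .
    next
      case False
      have "real (2 ^ k) \<le> real N" using k(1) by (simp only: of_nat_le_iff)
      then have "(2 ^ k) powr (- \<kappa>) \<le> real N powr (- \<kappa>)"
        using False by (intro powr_mono2) auto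
      also have "\<dots> \<le> 2 powr \<bar>\<kappa>\<bar> * real N powr (- \<kappa>)"
        using mult_right_mono[of 1 "2 powr \<bar>\<kappa>\<bar>" "real N powr (- \<kappa>)"] by (simp add: ge_one_powr_ge_zero)
      finally show ?thesis .
    qed
    also have "\<dots> \<le> real N powr e * real N powr (- \<kappa>)"
      using elim(1) by (rule mult_right_mono) simp
    also have "\<dots> = real N powr (- \<kappa> + e)" by (simp add: add.commute flip: powr_add)
    finally show ?case .
  qed
qed

text \<open>Bounds with an arbitrary fixed loss \<open>e\<close> are merged into one bound whose
  loss tends to 0, by reading the loss off from \<open>d\<close> itself.\<close>

lemma exponent_function_exists:
  fixes d :: "nat \<Rightarrow> real"
  assumes nonneg: "\<forall>\<^sub>F N in sequentially. 0 \<le> d N"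
    and ev: "\<And>e. e > 0 \<Longrightarrow> \<forall>\<^sub>F N in sequentially. d N < real N powr (- s + e)"
  shows "\<exists>f. f \<longlonglongrightarrow> 0 \<and> (\<forall>\<^sub>F N in sequentially. d N < 1 / real N powr (s - f N))"
proof -
  \<comment> \<open>The quotient of logarithms is the exponent of \<open>d N\<close> to the base
    \<open>N\<close>, and \<open>g\<close> is its excess over \<open>- s\<close>. It is cut off at 0
    because \<open>d N\<close> may be far smaller than \<open>N powr (- s)\<close>; the value
    \<open>d N = 0\<close> is separated since it has no meaningful logarithm.\<close>
  define g where "g N = (if d N = 0 then 0 else max 0 (s + ln (d N) / ln (real N)))" for N
  have "g \<longlonglongrightarrow> 0"
  proof (rule tendstoI)
    fix e :: real assume e: "e > 0"
    show "\<forall>\<^sub>F N in sequentially. dist (g N) 0 < e"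
      using nonneg ev[OF e] eventually_ge_at_top[of 2]
    proof eventually_elim
      case (elim N)
      show ?case
      proof (cases "d N = 0")
        case False
        then have "ln (d N) < ln (real N powr (- s + e))" using elim by (subst ln_less_cancel_iff) auto
        also have "\<dots> = (- s + e) * ln (real N)" using elim by (simp add: ln_powr)
        finally have "ln (d N) / ln (real N) < - s + e" using elim by (simp add: divide_less_eq)
        then show ?thesis using e False by (simp add: g_def)
      qed (simp add: g_def e)
    qed
  qed
  \<comment> \<open>By itself \<open>g\<close> only gives a non-strict inequality; adding
    \<open>1 / N\<close> makes it strict without disturbing the limit.\<close>
  then have "(\<lambda>N. g N + 1 / real N) \<longlonglongrightarrow> 0 + 0" by (intro tendsto_add lim_1_over_n)
  moreover have "\<forall>\<^sub>F N in sequentially. d N < 1 / real N powr (s - (g N + 1 / real N))"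
    using nonneg eventually_ge_at_top[of 2]
  proof eventually_elim
    case (elim N)
    show ?case
    proof (cases "d N = 0")
      case False
      then have dN: "d N > 0" using elim by simp
      have ln: "ln (real N) > 0" using elim by simp
      have "s + ln (d N) / ln (real N) \<le> g N" using False by (simp add: g_def)
      moreover have "0 < 1 / real N" using elim by simp
      ultimately have "ln (d N) / ln (real N) < g N + 1 / real N - s" by linarith
      then have "ln (d N) < (g N + 1 / real N - s) * ln (real N)" using ln by (simp add: pos_divide_less_eq)
      also have "\<dots> = ln (real N powr (g N + 1 / real N - s))" using elim by (simp add: ln_powr)
      finally have "d N < real N powr (g N + 1 / real N - s)" using dN elim by (subst (asm) ln_less_cancel_iff) auto
      also have "\<dots> = 1 / real N powr (s - (g N + 1 / real N))"
        by (simp add: powr_minus_divide[symmetric])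
      finally show ?thesis .
    qed (use elim in simp)
  qed
  ultimately show ?thesis by (intro exI[of _ "\<lambda>N. g N + 1 / real N"]) simp
qed

theorem theorem3:
  fixes x :: "nat \<Rightarrow> real" and c \<beta> :: real
  assumes LH: "lindelof_hypothesis"
    and pos: "\<forall>n\<ge>1. x n > 0"
    and c_pos: "c > 0"
    and gap: "\<forall>n\<ge>1. x (Suc n) - x n \<ge> c"
    and poly: "\<exists>C K. \<forall>n\<ge>1. \<bar>x n\<bar> \<le> K * real n powr C"
    and energy: "\<forall>\<epsilon>>0. \<exists>K. \<forall>N\<ge>1. real (add_energy x N) \<le> K * real N powr (\<beta> + \<epsilon>)"
  shows "AE \<alpha> in lborel. \<exists>f :: nat \<Rightarrow> real. f \<longlonglongrightarrow> 0 \<and>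
           (\<forall>\<^sub>F N in sequentially. delta_min x \<alpha> N < 1 / real N powr (4 - \<beta> - f N))"
proof -
  \<comment> \<open>Only the countably many losses \<open>1 / Suc j\<close> are used, so that one
    null set serves them all.\<close>
  define P where "P \<alpha> \<longleftrightarrow> (\<forall>j::nat. \<forall>\<^sub>F k in sequentially.
     delta_min x \<alpha> (2 ^ k) < (2 ^ k) powr (- (4 - \<beta> - 1 / real (Suc j))))" for \<alpha>
  obtain C K where CK: "\<forall>n\<ge>1. \<bar>x n\<bar> \<le> K * real n powr C" using poly by blast
  \<comment> \<open>The constants are enlarged to meet the requirements \<open>1 \<le> K\<close> and
    \<open>0 < C\<close> of the measure bound.\<close>
  have poly': "\<forall>n\<ge>1. x n \<le> (\<bar>K\<bar> + 1) * real n powr (max C 1)"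
  proof (intro allI impI)
    fix n :: nat assume n: "1 \<le> n"
    have "x n \<le> K * real n powr C" using CK n by fastforce
    also have "\<dots> \<le> (\<bar>K\<bar> + 1) * real n powr (max C 1)"
      using n by (intro mult_mono powr_mono) auto
    finally show "x n \<le> (\<bar>K\<bar> + 1) * real n powr (max C 1)" .
  qed
  have "AE y in lborel. \<forall>\<^sub>F k in sequentially. delta_min x (exp y) (2 ^ k) < (2 ^ k) powr (- (4 - \<beta> - 1 / real (Suc j)))" for j
  proof (cases "4 - \<beta> - 1 / real (Suc j) > 0")
    case True
    \<comment> \<open>The measure bound carries the factor \<open>exp (A\<^sup>2 / 2 + A)\<close>,
      so Borel-Cantelli is applied on one bounded window at a time; countably many windows exhaust
      the line.\<close>
    have "AE y in lborel. y \<in> {- real A..real A} \<longrightarrow>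
      (\<forall>\<^sub>F k in sequentially. delta_min x (exp y) (2 ^ k) < (2 ^ k) powr (- (4 - \<beta> - 1 / real (Suc j))))" for A :: nat
      by (rule delta_min_dyadic_AE[OF LH pos c_pos gap poly' _ _ energy _ refl True]) auto
    then have "AE y in lborel. \<forall>A::nat. y \<in> {- real A..real A} \<longrightarrow>
      (\<forall>\<^sub>F k in sequentially. delta_min x (exp y) (2 ^ k) < (2 ^ k) powr (- (4 - \<beta> - 1 / real (Suc j))))"
      by (subst AE_all_countable) blast
    then show ?thesis
    proof eventually_elim
      case (elim y)
      obtain A :: nat where "\<bar>y\<bar> \<le> real A" using real_arch_simple by blast
      then have "y \<in> {- real A..real A}" by auto
      then show ?case using elim by blast
    qed
  next
    case False
    \<comment> \<open>With a non-positive exponent the claim is trivial: the minimal gap is at most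
      1/2 and the right-hand side is at least 1.\<close>
    have "delta_min x \<alpha> (2 ^ k) < (2 ^ k) powr (- (4 - \<beta> - 1 / real (Suc j)))" if "k \<ge> 1" for \<alpha> k
    proof -
      have "(2::nat) ^ 1 \<le> 2 ^ k" using that by (rule power_increasing) simp
      then have "delta_min x \<alpha> (2 ^ k) \<le> 1 / 2" by (intro delta_min_le_half) simp
      also have "\<dots> < 1" by simp
      also have "1 \<le> (2 ^ k) powr (- (4 - \<beta> - 1 / real (Suc j)))"
        using False by (intro ge_one_powr_ge_zero) auto
      finally show ?thesis .
    qed
    then show ?thesis by (intro AE_I2 eventually_sequentiallyI[of 1])
  qed
  then have "AE y in lborel. P (exp y)" unfolding P_def by (subst AE_all_countable) blast
  then have "AE \<alpha> in lborel. P \<alpha>" by (rule AE_exp_imp_AE_even) (simp add: P_def delta_min_uminus)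
  then show ?thesis
  proof eventually_elim
    case (elim \<alpha>)
    show ?case
    proof (rule exponent_function_exists)
      show "\<forall>\<^sub>F N in sequentially. 0 \<le> delta_min x \<alpha> N"
        by (rule eventually_sequentiallyI[of 2]) (rule delta_min_nonneg)
      fix e :: real assume e: "e > 0"
      \<comment> \<open>Half of \<open>e\<close> covers the loss \<open>1 / Suc j\<close>, the other
        half the passage from powers of two to all \<open>N\<close>.\<close>
      then obtain j :: nat where j: "1 / real (Suc j) < e / 2"
        using reals_Archimedean[of "e / 2"] by (auto simp: inverse_eq_divide)
      have "\<forall>\<^sub>F N in sequentially. delta_min x \<alpha> N < real N powr (- (4 - \<beta> - 1 / real (Suc j)) + e / 2)"
        using elim e delta_min_antimono unfolding P_def
        by (intro eventually_dyadic_antimono) auto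
      then show "\<forall>\<^sub>F N in sequentially. delta_min x \<alpha> N < real N powr (- (4 - \<beta>) + e)"
        using eventually_ge_at_top[of 1]
      proof eventually_elim
        case (elim N)
        note elim(1)
        also have "real N powr (- (4 - \<beta> - 1 / real (Suc j)) + e / 2) \<le> real N powr (- (4 - \<beta>) + e)"
          using elim(2) j by (intro powr_mono) auto
        finally show ?case .
      qed
    qed
  qed
qed

end
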